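(* Let $I\subseteq\mathbb{R}$ be a nonempty open interval and let $(f,g)\in\mathscr{C}_1(I)$. Consider the following statements. (i) There exists a continuous strictly monotone function $h:I\to\mathbb{R}$ such that $\mathbb{C}_{f,g}(x,y)=\mathbb{A}_h(x,y)$ for all $x,y\in I$. (ii) $\mathbb{C}_{f,g}$ is bisymmetric, i.e. $\mathbb{C}_{f,g}(\mathbb{C}_{f,g}(x,y),\mathbb{C}_{f,g}(u,v))=\mathbb{C}_{f,g}(\mathbb{C}_{f,g}(x,u),\mathbb{C}_{f,g}(y,v))$ for all $x,y,u,v\in I$. (iii) There exist real constants $\alpha,\beta,\gamma,\delta,\varepsilon,\eta$ with $(\alpha,\beta,\gamma)\neq(0,0,0)$ such that $\alpha f^2+\beta fg+\gamma g^2+\delta f+\varepsilon g+\eta=0$ on $I$. (iv) There exist real constants $a,b,c$ such that $a(f')^2+bf'g'+c(g')^2=(W^{2,1}_{f,g})^{2/3}$ on $I$. (v) Let $h:I\to\mathbb{R}$ be an antiderivative of $(W^{2,1}_{f,g})^{1/3}$, and let $F:=f'/h'$, $G:=g'/h'$. Then $\mathbb{B}_{F,G}(x,y)=\mathbb{A}_h(x,y)$ for all $x,y\in I$. (vi) For $h:I\to\mathbb{R}$ an antiderivative of $(W^{2,1}_{f,g})^{1/3}$, one has $\mathbb{C}_{f,g}(x,y)=\mathbb{A}_h(x,y)$ for all $x,y\in I$. (vii) The function \[ \frac{3W^{4,1}_{f,g}+12W^{3,2}_{f,g}}{\big(W^{2,1}_{f,g}\big)^{5/3}}-5\,\frac{\big(W^{3,1}_{f,g}\big)^2}{\big(W^{2,1}_{f,g}\big)^{8/3}}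 \] is constant on $I$. Then statements (i), (ii), (iii) are equivalent. If, in addition, $(f,g)\in\mathscr{C}_2(I)$, then statements (i)–(vi) are all equivalent. If, in addition, $(f,g)\in\mathscr{C}_4(I)$, then statements (i)–(vii) are all equivalent.
   Context: $I$ is a nonempty open interval. For a continuous strictly monotone $\varphi:I\to\mathbb{R}$, the quasiarithmetic mean is $\mathbb{A}_\varphi(x,y):=\varphi^{-1}\big(\frac{\varphi(x)+\varphi(y)}{2}\big)$. For $F,G:I\to\mathbb{R}$ with $G$ nowhere zero and $F/G$ continuous and strictly monotone, the Bajraktarević mean is $\mathbb{B}_{F,G}(x,y):=(F/G)^{-1}\big(\frac{F(x)+F(y)}{G(x)+G(y)}\big)$. For differentiable $f,g$ with $g'$ nowhere zero and $f'/g'$ strictly monotone, the Cauchy mean is $\mathbb{C}_{f,g}(x,y):=(f'/g')^{-1}\big(\frac{f(x)-f(y)}{g(x)-g(y)}\big)$ if $x\neq y$ and $\mathbb{C}_{f,g}(x,x):=x$. The class $\mathscr{C}_1(I)$ consists of all pairs $(f,g)$ of continuously differentiable functions $f,g:I\to\mathbb{R}$ with $g'$ nowhere zero on $I$ and $f'/g'$ strictly monotone on $I$. For $n\ge 2$, $\mathscr{C}_n(I)$ consists of all pairs $(f,g)$ of $n$ times continuously differentiable functions $f,g:I\to\mathbb{R}$ with $g'$ nowhere zero on $I$ and $(f'/g')'$ nowhere zero on $I$. For $i,j\ge 0$, $W^{i,j}_{f,g}:=f^{(i)}g^{(j)}-f^{(j)}g^{(i)}$ (the determinant with first row $f^{(i)},f^{(j)}$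 and second row $g^{(i)},g^{(j)}$). For $(f,g)\in\mathscr{C}_2(I)$ one has $W^{2,1}_{f,g}=(g')^2(f'/g')'$, which is nowhere zero. Powers $(W^{2,1}_{f,g})^{k/3}$ are understood as $k$-th powers of the real cube root. *)

theory Defs
  imports "HOL-Analysis.Analysis"
begin

definition strictly_monotone_on :: "real set \<Rightarrow> (real \<Rightarrow> real) \<Rightarrow> bool" where
  "strictly_monotone_on I h \<longleftrightarrow> strict_mono_on I h \<or> strict_antimono_on I h"

definition qa_mean :: "real set \<Rightarrow> (real \<Rightarrow> real) \<Rightarrow> real \<Rightarrow> real \<Rightarrow> real" where
  "qa_mean I \<phi> x y = the_inv_into I \<phi> ((\<phi> x + \<phi> y) / 2)"

definition bajr_mean :: "real set \<Rightarrow> (real \<Rightarrow> real) \<Rightarrow> (real \<Rightarrow> real) \<Rightarrow> real \<Rightarrow> real \<Rightarrow> real" where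
  "bajr_mean I F G x y = the_inv_into I (\<lambda>t. F t / G t) ((F x + F y) / (G x + G y))"

definition cauchy_mean :: "real set \<Rightarrow> (real \<Rightarrow> real) \<Rightarrow> (real \<Rightarrow> real) \<Rightarrow> real \<Rightarrow> real \<Rightarrow> real" where
  "cauchy_mean I f g x y =
     (if x = y then x
      else the_inv_into I (\<lambda>t. deriv f t / deriv g t) ((f x - f y) / (g x - g y)))"

definition Cn_on :: "nat \<Rightarrow> real set \<Rightarrow> (real \<Rightarrow> real) \<Rightarrow> bool" where
  "Cn_on n I f \<longleftrightarrow>
     (\<forall>k<n. \<forall>x\<in>I. ((deriv ^^ k) f has_real_derivative (deriv ^^ Suc k) f x) (at x))
     \<and> continuous_on I ((deriv ^^ n) f)"

definition class_C1 :: "real set \<Rightarrow> (real \<Rightarrow> real) \<Rightarrow> (real \<Rightarrow> real) \<Rightarrow> bool" where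
  "class_C1 I f g \<longleftrightarrow> Cn_on 1 I f \<and> Cn_on 1 I g \<and> (\<forall>x\<in>I. deriv g x \<noteq> 0)
     \<and> strictly_monotone_on I (\<lambda>t. deriv f t / deriv g t)"

text \<open>The class C_n(I) for n >= 2.\<close>
definition class_Cn :: "nat \<Rightarrow> real set \<Rightarrow> (real \<Rightarrow> real) \<Rightarrow> (real \<Rightarrow> real) \<Rightarrow> bool" where
  "class_Cn n I f g \<longleftrightarrow> Cn_on n I f \<and> Cn_on n I g \<and> (\<forall>x\<in>I. deriv g x \<noteq> 0)
     \<and> (\<forall>x\<in>I. deriv (\<lambda>t. deriv f t / deriv g t) x \<noteq> 0)"

definition Wron :: "nat \<Rightarrow> nat \<Rightarrow> (real \<Rightarrow> real) \<Rightarrow> (real \<Rightarrow> real) \<Rightarrow> real \<Rightarrow> real" where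
  "Wron i j f g x = (deriv ^^ i) f x * (deriv ^^ j) g x - (deriv ^^ j) f x * (deriv ^^ i) g x"

text \<open>w^(k/3) as the k-th power of the real cube root.\<close>
definition pow3 :: "real \<Rightarrow> nat \<Rightarrow> real" where
  "pow3 w k = (root 3 w) ^ k"

end

theory Submission
  imports Defs
begin

text \<open>
  The Cauchy mean \<open>C(x, y)\<close> is the parameter at which the tangent of the curve \<open>(g, f)\<close> is parallel
  to the chord over \<open>x, y\<close>, so the theorem is about families of parallel chords.

  If \<open>C\<close> is bisymmetric, iterated means give finite progressions of points of the curve in which chords
  with equal index sum are parallel. An affine map then shifts such a progression by one step and
  preserves a conic through it. By compactness of the set of normalized conic coefficients and density
  of the iterated means, the whole curve lies on one conic.

  Conversely, on a conic \<open>Q = 0\<close> the chord over \<open>x, y\<close> has slope \<open>- (B x + B y) / (A x + A y)\<close>, where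
  \<open>(A, B)\<close> is the gradient of \<open>Q\<close> along the curve. With respect to an antiderivative \<open>h\<close> of
  \<open>g' / A = - f' / B\<close> both \<open>A\<close> and \<open>B\<close> solve a linear equation \<open>e'' = \<kappa> e\<close> with constant \<open>\<kappa>\<close>, hence this
  slope is that of the tangent at the \<open>h\<close>-midpoint. Moreover \<open>h'\<close> is proportional to the cube root of
  the Wronskian \<open>W\<close>, and the function in (vii) equals \<open>- 9 p\<close>, where \<open>F'' = p F\<close> and \<open>G'' = p G\<close> are
  satisfied by \<open>F = f' / h'\<close> and \<open>G = g' / h'\<close> as functions of the parameter \<open>h\<close>.
\<close>

section \<open>Real functions on an interval\<close>

lemma sgn_eq_if_nonzero_on_interval:
  fixes p :: "real \<Rightarrow> real"
  assumes "is_interval I" "continuous_on I p" "\<And>x. x \<in> I \<Longrightarrow> p x \<noteq> 0" "x \<in> I" "y \<in> I"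
  shows "sgn (p x) = sgn (p y)"
proof (rule ccontr)
  assume "sgn (p x) \<noteq> sgn (p y)"
  then have "p x < 0 \<and> 0 < p y \<or> p y < 0 \<and> 0 < p x"
    using assms(3)[OF assms(4)] assms(3)[OF assms(5)]
    by (auto simp: sgn_real_def split: if_splits)
  moreover have "is_interval (p ` I)"
    using assms(1,2) connected_continuous_image is_interval_connected_1 by blast
  ultimately have "0 \<in> p ` I"
    using assms(4,5) unfolding is_interval_1 by (meson imageI less_imp_le)
  then show False
    using assms(3) by auto
qed

lemma inj_on_if_deriv_nonzero:
  fixes h :: "real \<Rightarrow> real"
  assumes "is_interval I" and der: "\<And>x. x \<in> I \<Longrightarrow> (h has_real_derivative k x) (at x)"
    and nz: "\<And>x. x \<in> I \<Longrightarrow> k x \<noteq> 0"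
  shows "inj_on h I"
proof (rule inj_onI, rule ccontr)
  have less_case: False if "x \<in> I" "y \<in> I" "x < y" "h x = h y" for x y
  proof -
    have sub: "{x..y} \<subseteq> I"
      using that assms(1) unfolding is_interval_1 by (meson atLeastAtMost_iff subsetI)
    have "\<exists>z. x < z \<and> z < y \<and> h y - h x = (y - x) * k z"
      using that(3) sub by (intro MVT2) (auto intro: der)
    then obtain z where "x < z" "z < y" "h y - h x = (y - x) * k z"
      by blast
    then show False
      using that nz[of z] subsetD[OF sub, of z] by simp
  qed
  fix x y assume "x \<in> I" "y \<in> I" "h x = h y" "x \<noteq> y"
  then show False
    using less_case[of x y] less_case[of y x] by (cases x y rule: linorder_cases) auto
qed

lemma strictly_monotone_on_imp_inj_on:
  "strictly_monotone_on I h \<Longrightarrow> inj_on h I"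
  unfolding strictly_monotone_on_def inj_on_def monotone_on_def
  by (metis linorder_neqE_linordered_idom order_less_irrefl)

text \<open>The proof takes \<open>\<sigma>\<close> to be 1 or -1, so that later order arguments
  treat increasing and decreasing functions at once.\<close>

lemma strictly_monotone_on_signE:
  assumes "strictly_monotone_on I h"
  obtains \<sigma> :: real where "\<And>x y. x \<in> I \<Longrightarrow> y \<in> I \<Longrightarrow> x < y \<Longrightarrow> \<sigma> * h x < \<sigma> * h y"
proof -
  have "(\<forall>x\<in>I. \<forall>y\<in>I. x < y \<longrightarrow> 1 * h x < 1 * h y) \<or> (\<forall>x\<in>I. \<forall>y\<in>I. x < y \<longrightarrow> (-1) * h x < (-1) * h y)"
    using assms unfolding strictly_monotone_on_def monotone_on_def by auto
  then show ?thesis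
    using that by blast
qed

lemma strictly_monotone_on_if_deriv_nonzero:
  fixes h :: "real \<Rightarrow> real"
  assumes I: "is_interval I" and der: "\<And>x. x \<in> I \<Longrightarrow> (h has_real_derivative k x) (at x)"
    and nz: "\<And>x. x \<in> I \<Longrightarrow> k x \<noteq> 0" and cont: "continuous_on I k"
  shows "strictly_monotone_on I h"
proof (cases "\<exists>a\<in>I. k a > 0")
  case True
  then have pos: "k x > 0" if "x \<in> I" for x
    using sgn_eq_if_nonzero_on_interval[OF I cont nz _ that] by (metis sgn_greater)
  have "h x < h y" if "x \<in> I" "y \<in> I" "x < y" for x y
  proof (rule DERIV_pos_imp_increasing[OF that(3)])
    fix z assume "x \<le> z" "z \<le> y"
    then have "z \<in> I" using that I unfolding is_interval_1 by blast
    then show "\<exists>d. DERIV h z :> d \<and> d > 0" using der pos by blast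
  qed
  then show ?thesis
    unfolding strictly_monotone_on_def monotone_on_def by blast
next
  case False
  then have neg: "k x < 0" if "x \<in> I" for x
    using nz[OF that] that by force
  have "h y < h x" if "x \<in> I" "y \<in> I" "x < y" for x y
  proof (rule DERIV_neg_imp_decreasing[OF that(3)])
    fix z assume "x \<le> z" "z \<le> y"
    then have "z \<in> I" using that I unfolding is_interval_1 by blast
    then show "\<exists>d. DERIV h z :> d \<and> d < 0" using der neg by blast
  qed
  then show ?thesis
    unfolding strictly_monotone_on_def monotone_on_def by blast
qed

lemma constant_if_deriv_zero_on_interval:
  fixes p :: "real \<Rightarrow> real"
  assumes "is_interval I" "\<And>x. x \<in> I \<Longrightarrow> (p has_real_derivative 0) (at x)" "x \<in> I" "y \<in> I"
  shows "p x = p y"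
proof -
  have "\<exists>c. \<forall>x\<in>I. p x = c"
    using assms(1,2) by (intro has_field_derivative_zero_constant)
      (auto simp: is_interval_convex_1 intro: has_field_derivative_at_within)
  then show ?thesis
    using assms(3,4) by auto
qed

lemma deriv_zero_if_constant_on_open:
  fixes p :: "real \<Rightarrow> real"
  assumes "open I" "x \<in> I" "\<And>t. t \<in> I \<Longrightarrow> p t = c" "(p has_real_derivative D) (at x)"
  shows "D = 0"
proof -
  have "((\<lambda>t. c) has_real_derivative D) (at x)"
    by (rule has_field_derivative_transform_within_open[OF assms(4,1,2,3)])
  then show ?thesis
    using DERIV_unique[OF _ DERIV_const] by blast
qed

text \<open>An open interval, bounded or not, consists of the reals strictly between its extended
  real endpoints, which is the form that \<open>einterval_antiderivative\<close> works with.\<close>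

lemma open_interval_antiderivative:
  fixes p :: "real \<Rightarrow> real"
  assumes I: "open I" "is_interval I" "I \<noteq> {}" and cont: "continuous_on I p"
  obtains h where "\<And>x. x \<in> I \<Longrightarrow> (h has_real_derivative p x) (at x)"
proof -
  define a where "a = Inf (ereal ` I)"
  define b where "b = Sup (ereal ` I)"
  have in_I: "x \<in> I" if ax: "a < ereal x" and xb: "ereal x < b" for x
  proof -
    obtain y where "y \<in> I" "y < x"
      using ax unfolding a_def Inf_less_iff by auto
    moreover obtain z where "z \<in> I" "x < z"
      using xb unfolding b_def less_Sup_iff by auto
    ultimately show ?thesis
      using I(2) unfolding is_interval_1 by (meson less_imp_le)
  qed
  have in_ab: "a < ereal x \<and> ereal x < b" if xI: "x \<in> I" for x
  proof -
    obtain e where e: "e > 0" "ball x e \<subseteq> I"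
      using openE[OF I(1) xI] by blast
    then have "x - e/2 \<in> I" "x + e/2 \<in> I"
      by (auto simp: subset_eq dist_real_def)
    then have "a \<le> ereal (x - e/2)" "ereal (x + e/2) \<le> b"
      unfolding a_def b_def by (auto intro: Inf_lower Sup_upper)
    moreover have "ereal (x - e/2) < ereal x" "ereal x < ereal (x + e/2)"
      using e(1) by auto
    ultimately show ?thesis
      using le_less_trans less_le_trans by blast
  qed
  have "a < b"
    using I(3) in_ab by (meson all_not_in_conv less_trans)
  then have "\<exists>F. \<forall>x :: real. a < x \<longrightarrow> x < b \<longrightarrow> (F has_vector_derivative p x) (at x)"
    using in_I I(1) cont by (intro einterval_antiderivative) (auto simp: continuous_on_eq_continuous_at)
  then show ?thesis
    using that in_ab by (auto simp: has_real_derivative_iff_has_vector_derivative)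
qed

text \<open>Near \<open>x\<close> continuity fixes the sign of \<open>w\<close>, so \<open>w\<close>
  is that sign times the root of its square. This serves to differentiate the cube root of a
  Wronskian known only to be continuous.\<close>

lemma has_real_derivative_if_square_has_real_derivative:
  fixes w :: "real \<Rightarrow> real"
  assumes "open I" "continuous_on I w" "x \<in> I" "w x \<noteq> 0"
    and der: "((\<lambda>t. (w t)\<^sup>2) has_real_derivative D) (at x)"
  shows "(w has_real_derivative D / (2 * w x)) (at x)"
proof -
  have "isCont w x"
    using assms(1-3) continuous_on_eq_continuous_at by blast
  then have lim: "(w \<longlongrightarrow> w x) (nhds x)"
    by (simp add: continuous_at_imp_continuous_at_within isCont_def tendsto_nhds_iff)
  have ev: "eventually (\<lambda>t. w t = sgn (w x) * sqrt ((w t)\<^sup>2)) (nhds x)"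
  proof (cases "w x > 0")
    case True
    then show ?thesis
      using order_tendstoD(1)[OF lim, of 0] by (auto elim!: eventually_mono)
  next
    case False
    then have "w x < 0" using assms(4) by simp
    then show ?thesis
      using order_tendstoD(2)[OF lim, of 0] by (auto elim!: eventually_mono)
  qed
  have "((\<lambda>t. sgn (w x) * sqrt ((w t)\<^sup>2)) has_real_derivative
      sgn (w x) * (inverse (sqrt ((w x)\<^sup>2)) / 2 * D)) (at x)"
    using assms(4) by (intro DERIV_cmult DERIV_chain2[OF DERIV_real_sqrt der]) auto
  moreover have "sgn (w x) * (inverse (sqrt ((w x)\<^sup>2)) / 2 * D) = D / (2 * w x)"
    using assms(4) by (auto simp: sgn_real_def abs_if field_simps)
  ultimately show ?thesis
    by (simp only: DERIV_cong_ev[OF refl ev refl])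
qed

section \<open>Second-order linear equations with a constant coefficient\<close>

text \<open>Uniformly in the sign of \<open>\<kappa>\<close>, these play the roles of \<open>cosh (t * sqrt \<kappa>)\<close> and
  \<open>sinh (t * sqrt \<kappa>) / sqrt \<kappa>\<close>.\<close>

lemma generalized_cosh_sinh:
  fixes \<kappa> :: real
  obtains c s :: "real \<Rightarrow> real"
  where "\<And>t. (c has_real_derivative \<kappa> * s t) (at t)" "\<And>t. (s has_real_derivative c t) (at t)"
    "c 0 = 1" "s 0 = 0" "\<And>t. c (- t) = c t" "\<And>t. s (- t) = - s t"
    "\<And>t. (c t)\<^sup>2 - \<kappa> * (s t)\<^sup>2 = 1"
proof (cases \<kappa> "0 :: real" rule: linorder_cases)
  case less
  define r where "r = sqrt (- \<kappa>)"
  have r: "r > 0" "\<kappa> = - (r * r)"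
    using less unfolding r_def by auto
  show ?thesis
  proof (rule that[of "\<lambda>t. cos (r * t)" "\<lambda>t. sin (r * t) / r"])
    show "(cos (r * t))\<^sup>2 - \<kappa> * (sin (r * t) / r)\<^sup>2 = 1" for t
      using r sin_cos_squared_add2[of "r * t"] by (simp add: power2_eq_square)
  qed (use r in \<open>auto intro!: derivative_eq_intros\<close>)
next
  case equal
  show ?thesis
    by (rule that[of "\<lambda>t. 1" "\<lambda>t. t"]) (use equal in \<open>auto intro!: derivative_eq_intros\<close>)
next
  case greater
  define r where "r = sqrt \<kappa>"
  have r: "r > 0" "\<kappa> = r * r"
    using greater unfolding r_def by auto
  show ?thesis
  proof (rule that[of "\<lambda>t. cosh (r * t)" "\<lambda>t. sinh (r * t) / r"])
    show "(cosh (r * t))\<^sup>2 - \<kappa> * (sinh (r * t) / r)\<^sup>2 = 1" for t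
      using r by (simp add: power_divide cosh_square_eq)
        (simp add: power2_eq_square)
  qed (use r in \<open>auto intro!: derivative_eq_intros\<close>)
qed

text \<open>One factor \<open>C\<close> serves all solutions of \<open>e'' = \<kappa> e\<close>, so that it cancels in quotients of solutions.\<close>

lemma midpoint_of_linear_ode:
  fixes h H :: "real \<Rightarrow> real" and \<kappa> :: real
  assumes I: "is_interval I" and h: "\<And>x. x \<in> I \<Longrightarrow> (h has_real_derivative H x) (at x)"
    and xyz: "x \<in> I" "y \<in> I" "z \<in> I" "h z = (h x + h y) / 2"
  shows "\<exists>C. \<forall>e e\<^sub>2. (\<forall>t\<in>I. (e has_real_derivative H t * e\<^sub>2 t) (at t)) \<longrightarrow>
    (\<forall>t\<in>I. (e\<^sub>2 has_real_derivative H t * (\<kappa> * e t)) (at t)) \<longrightarrow> e x + e y = C * e z"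
proof -
  obtain c s :: "real \<Rightarrow> real" where c: "\<And>t. (c has_real_derivative \<kappa> * s t) (at t)"
    and s: "\<And>t. (s has_real_derivative c t) (at t)"
    and cs: "c 0 = 1" "s 0 = 0" "\<And>t. c (- t) = c t" "\<And>t. s (- t) = - s t"
    "\<And>t. (c t)\<^sup>2 - \<kappa> * (s t)\<^sup>2 = 1"
    by (rule generalized_cosh_sinh[of \<kappa>]) (rule that)
  show ?thesis
  proof (intro exI[of _ "2 * c (h x - h z)"] allI impI)
    fix e e\<^sub>2
    assume "\<forall>t\<in>I. (e has_real_derivative H t * e\<^sub>2 t) (at t)"
      and "\<forall>t\<in>I. (e\<^sub>2 has_real_derivative H t * (\<kappa> * e t)) (at t)"
    then have e: "\<And>t. t \<in> I \<Longrightarrow> (e has_real_derivative H t * e\<^sub>2 t) (at t)"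
      and e2: "\<And>t. t \<in> I \<Longrightarrow> (e\<^sub>2 has_real_derivative H t * (\<kappa> * e t)) (at t)"
      by auto
    have ch: "((\<lambda>t. c (h t - h z)) has_real_derivative \<kappa> * s (h t - h z) * H t) (at t)"
      and sh: "((\<lambda>t. s (h t - h z)) has_real_derivative c (h t - h z) * H t) (at t)"
      if "t \<in> I" for t
    proof -
      have "((\<lambda>t. h t - h z) has_real_derivative H t) (at t)"
        using h[OF that] by (auto intro!: derivative_eq_intros)
      then show "((\<lambda>t. c (h t - h z)) has_real_derivative \<kappa> * s (h t - h z) * H t) (at t)"
        "((\<lambda>t. s (h t - h z)) has_real_derivative c (h t - h z) * H t) (at t)"
        using DERIV_chain2[OF c] DERIV_chain2[OF s] by blast+
    qed
    have sol: "e t = c (h t - h z) * e z + s (h t - h z) * e\<^sub>2 z" if t: "t \<in> I" for t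
    proof -
      \<comment> \<open>\<open>U\<close> and \<open>V\<close> are first integrals; the identity
        between \<open>c\<close> and \<open>s\<close> inverts the pair and recovers
        \<open>e t\<close>.\<close>
      have U: "c (h t - h z) * e t - s (h t - h z) * e\<^sub>2 t = c (h z - h z) * e z - s (h z - h z) * e\<^sub>2 z"
        by (rule constant_if_deriv_zero_on_interval[OF I _ t xyz(3)],
            rule DERIV_cong, (rule DERIV_diff DERIV_cmult DERIV_mult ch sh e e2 | assumption)+,
            simp add: algebra_simps)
      have V: "c (h t - h z) * e\<^sub>2 t - \<kappa> * (s (h t - h z) * e t)
          = c (h z - h z) * e\<^sub>2 z - \<kappa> * (s (h z - h z) * e z)"
        by (rule constant_if_deriv_zero_on_interval[OF I _ t xyz(3)],
            rule DERIV_cong, (rule DERIV_diff DERIV_cmult DERIV_mult ch sh e e2 | assumption)+,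
            simp add: algebra_simps)
      have "e t = ((c (h t - h z))\<^sup>2 - \<kappa> * (s (h t - h z))\<^sup>2) * e t"
        using cs(5) by simp
      also have "\<dots> = c (h t - h z) * (c (h t - h z) * e t - s (h t - h z) * e\<^sub>2 t)
          + s (h t - h z) * (c (h t - h z) * e\<^sub>2 t - \<kappa> * (s (h t - h z) * e t))"
        by (simp add: algebra_simps power2_eq_square)
      also have "\<dots> = c (h t - h z) * e z + s (h t - h z) * e\<^sub>2 z"
        unfolding U V by (simp add: cs)
      finally show ?thesis .
    qed
    \<comment> \<open>The offsets from the midpoint are opposite, \<open>c\<close> is even and
      \<open>s\<close> is odd, so the terms with \<open>e\<^sub>2 z\<close> cancel in the
      sum.\<close>
    have "h y - h z = - (h x - h z)"
      using xyz(4) by simp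
    then show "e x + e y = 2 * c (h x - h z) * e z"
      using sol[OF xyz(1)] sol[OF xyz(2)] cs(3,4)[of "h x - h z"]
      by (simp only:)
  qed
qed

lemma qa_mean_eqI:
  assumes "inj_on h I" "z \<in> I" "h z = (h x + h y) / 2"
  shows "qa_mean I h x y = z"
  unfolding qa_mean_def using assms by (intro the_inv_into_f_eq)

lemma interval_IVT_between:
  fixes p :: "real \<Rightarrow> real"
  assumes "is_interval I" "continuous_on I p" "x \<in> I" "y \<in> I"
    "min (p x) (p y) \<le> v" "v \<le> max (p x) (p y)"
  obtains z where "z \<in> I" "p z = v"
proof -
  have "is_interval (p ` I)"
    using assms(1,2) connected_continuous_image is_interval_connected_1 by blast
  moreover have "p x \<le> v \<and> v \<le> p y \<or> p y \<le> v \<and> v \<le> p x"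
    using assms(5,6) by (auto simp: min_def max_def split: if_splits)
  ultimately have "v \<in> p ` I"
    using assms(3,4) unfolding is_interval_1 by blast
  then show ?thesis
    using that by blast
qed

lemma qa_mean:
  assumes "is_interval I" "continuous_on I h" "inj_on h I" "x \<in> I" "y \<in> I"
  shows "qa_mean I h x y \<in> I" "h (qa_mean I h x y) = (h x + h y) / 2"
proof -
  obtain z where "z \<in> I" "h z = (h x + h y) / 2"
    by (rule interval_IVT_between[OF assms(1,2,4,5), of "(h x + h y) / 2"]) auto
  then show "qa_mean I h x y \<in> I" "h (qa_mean I h x y) = (h x + h y) / 2"
    using qa_mean_eqI[OF assms(3)] by auto
qed

section \<open>Cauchy means\<close>

locale cauchy_pair =
  fixes I :: "real set" and f g :: "real \<Rightarrow> real"
  assumes I_open: "open I" and I_int: "is_interval I" and I_ne: "I \<noteq> {}"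
    and C1: "class_C1 I f g"
begin

abbreviation M :: "real \<Rightarrow> real \<Rightarrow> real" where
  "M \<equiv> cauchy_mean I f g"

definition \<phi> :: "real \<Rightarrow> real" where
  "\<phi> t = deriv f t / deriv g t"

lemma Df: "x \<in> I \<Longrightarrow> (f has_real_derivative deriv f x) (at x)"
  and Dg: "x \<in> I \<Longrightarrow> (g has_real_derivative deriv g x) (at x)"
  and deriv_g_nonzero: "x \<in> I \<Longrightarrow> deriv g x \<noteq> 0"
  and continuous_deriv_f: "continuous_on I (deriv f)"
  and continuous_deriv_g: "continuous_on I (deriv g)"
  using C1 unfolding class_C1_def Cn_on_def by auto

lemma strictly_monotone_\<phi>: "strictly_monotone_on I \<phi>"
  using C1 unfolding class_C1_def \<phi>_def[abs_def] by auto

lemma inj_\<phi>: "inj_on \<phi> I"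
  by (rule strictly_monotone_on_imp_inj_on[OF strictly_monotone_\<phi>])

lemma continuous_\<phi>: "continuous_on I \<phi>"
  unfolding \<phi>_def[abs_def]
  by (intro continuous_on_divide continuous_deriv_f continuous_deriv_g ballI deriv_g_nonzero)

lemma continuous_f: "continuous_on I f"
  by (rule DERIV_continuous_on) (rule has_field_derivative_at_within[OF Df])

lemma continuous_g: "continuous_on I g"
  by (rule DERIV_continuous_on) (rule has_field_derivative_at_within[OF Dg])

lemma inj_g: "inj_on g I"
  by (rule inj_on_if_deriv_nonzero[OF I_int Dg deriv_g_nonzero])

lemma deriv_f_eq: "x \<in> I \<Longrightarrow> deriv f x = \<phi> x * deriv g x"
  using deriv_g_nonzero by (simp add: \<phi>_def)

lemma mem_I_between: "x \<in> I \<Longrightarrow> y \<in> I \<Longrightarrow> x \<le> z \<Longrightarrow> z \<le> y \<Longrightarrow> z \<in> I"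
  using I_int unfolding is_interval_1 by blast

lemma M_diag [simp]: "M x x = x"
  by (simp add: cauchy_mean_def)

lemma M_eqI:
  assumes "x \<in> I" "y \<in> I" "x \<noteq> y" "z \<in> I" "f x - f y = \<phi> z * (g x - g y)"
  shows "M x y = z"
proof -
  have "g x \<noteq> g y"
    using assms inj_g by (auto dest: inj_onD)
  then have "\<phi> z = (f x - f y) / (g x - g y)"
    using assms(5) by simp
  then have "the_inv_into I \<phi> ((f x - f y) / (g x - g y)) = z"
    using assms(4) inj_\<phi> by (intro the_inv_into_f_eq) auto
  then show ?thesis
    using assms(3) unfolding cauchy_mean_def \<phi>_def[abs_def] by simp
qed

lemma M_commute: "x \<in> I \<Longrightarrow> y \<in> I \<Longrightarrow> M x y = M y x"
  unfolding cauchy_mean_def using minus_divide_divide[of "f x - f y" "g x - g y"] by simp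

text \<open>Cauchy's mean value theorem supplies a strictly intermediate parameter with the slope of
  the chord, and \<open>M_eqI\<close> identifies it as the mean.\<close>

lemma M_strict_mean:
  assumes "x \<in> I" "y \<in> I" "x < y"
  shows "x < M x y" "M x y < y" "M x y \<in> I" "f x - f y = \<phi> (M x y) * (g x - g y)"
proof -
  have sub: "z \<in> I" if "x \<le> z" "z \<le> y" for z
    using that assms mem_I_between by blast
  have "\<exists>c. x < c \<and> c < y \<and> (f y - f x) * deriv g c = (g y - g x) * deriv f c"
    using assms(3) sub by (intro GMVT') (auto intro: Df Dg DERIV_isCont)
  then obtain c where c: "x < c" "c < y" "(f y - f x) * deriv g c = (g y - g x) * deriv f c"
    by blast
  have cI: "c \<in> I"
    using sub c by auto
  have "f x - f y = \<phi> c * (g x - g y)"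
    using c(3) deriv_g_nonzero[OF cI] unfolding \<phi>_def by (simp add: field_simps)
  moreover from this have "M x y = c"
    using M_eqI[OF assms(1,2) _ cI] assms(3) by simp
  ultimately show "x < M x y" "M x y < y" "M x y \<in> I" "f x - f y = \<phi> (M x y) * (g x - g y)"
    using c cI by auto
qed

lemma M_in: "x \<in> I \<Longrightarrow> y \<in> I \<Longrightarrow> M x y \<in> I"
  using M_strict_mean(3)[of x y] M_strict_mean(3)[of y x] M_commute[of x y]
  by (cases x y rule: linorder_cases) auto

lemma M_chord: "x \<in> I \<Longrightarrow> y \<in> I \<Longrightarrow> f x - f y = \<phi> (M x y) * (g x - g y)"
  using M_strict_mean(4)[of x y] M_strict_mean(4)[of y x] M_commute[of x y]
  by (cases x y rule: linorder_cases) (auto simp: algebra_simps)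

lemma D_affine:
  assumes "x \<in> I"
  shows "((\<lambda>x. p * f x + q * g x + r) has_real_derivative p * deriv f x + q * deriv g x) (at x)"
  using DERIV_add[OF DERIV_add[OF DERIV_cmult[OF Df[OF assms]] DERIV_cmult[OF Dg[OF assms]]] DERIV_const]
  by simp

text \<open>A line with \<open>\<delta>\<close> nonzero has a single slope, whereas
  \<open>\<phi>\<close> takes distinct values. This rules out conics with vanishing quadratic
  part.\<close>

lemma not_on_line:
  assumes "\<And>x. x \<in> I \<Longrightarrow> \<delta> * f x + \<epsilon> * g x + \<eta> = 0"
  shows "\<delta> = 0 \<and> \<epsilon> = 0 \<and> \<eta> = 0"
proof -
  obtain a where a: "a \<in> I" using I_ne by blast
  obtain e where e: "e > 0" "ball a e \<subseteq> I"
    using openE[OF I_open a] by blast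
  define b where "b = a + e / 2"
  have b: "b \<in> I" "b \<noteq> a"
    using e unfolding b_def by (auto simp: subset_eq dist_real_def)
  have lin: "\<delta> * \<phi> x + \<epsilon> = 0" if x: "x \<in> I" for x
  proof -
    have "\<delta> * deriv f x + \<epsilon> * deriv g x = 0"
      by (rule deriv_zero_if_constant_on_open[OF I_open x assms D_affine[OF x]])
    then have "(\<delta> * \<phi> x + \<epsilon>) * deriv g x = 0"
      unfolding deriv_f_eq[OF x] by (simp add: algebra_simps)
    then show ?thesis
      using deriv_g_nonzero[OF x] by simp
  qed
  have "\<phi> a \<noteq> \<phi> b"
    using a b inj_\<phi> by (auto dest: inj_onD)
  moreover have "\<delta> * (\<phi> a - \<phi> b) = 0"
    unfolding right_diff_distrib using lin[OF a] lin[OF b(1)] by linarith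
  ultimately show ?thesis
    using lin[OF a] assms[OF a] by simp
qed

subsection \<open>Bisymmetry puts the curve on a conic\<close>

text \<open>The monomials of degree at most two: a conic through a point of the curve becomes a
  coefficient vector orthogonal to this vector.\<close>

definition conic_vec :: "real \<Rightarrow> real \<times> real \<times> real \<times> real \<times> real \<times> real" where
  "conic_vec x = ((f x)\<^sup>2, f x * g x, (g x)\<^sup>2, f x, g x, 1)"

definition on_conic :: "real set \<Rightarrow> bool" where
  "on_conic S \<longleftrightarrow> (\<exists>q. q \<noteq> 0 \<and> (\<forall>x\<in>S. q \<bullet> conic_vec x = 0))"

lemma on_conic_subset: "on_conic S \<Longrightarrow> T \<subseteq> S \<Longrightarrow> on_conic T"
  unfolding on_conic_def by blast

text \<open>Coefficient vectors can be normalized to the compact unit sphere, and each point imposes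
  a closed condition on them; the finite intersection property applies.\<close>

lemma on_conic_if_finite_subsets:
  assumes "\<And>F. finite F \<Longrightarrow> F \<subseteq> S \<Longrightarrow> on_conic F"
  shows "on_conic S"
proof -
  have "sphere (0 :: real \<times> real \<times> real \<times> real \<times> real \<times> real) 1 \<inter> (\<Inter>x\<in>S. {q. q \<bullet> conic_vec x = 0}) \<noteq> {}"
  proof (rule compact_imp_fip_image)
    fix F assume F: "finite F" "F \<subseteq> S"
    obtain q where q: "q \<noteq> 0" "\<And>x. x \<in> F \<Longrightarrow> q \<bullet> conic_vec x = 0"
      using assms[OF F] unfolding on_conic_def by blast
    have "q /\<^sub>R norm q \<in> sphere 0 1 \<inter> (\<Inter>x\<in>F. {q. q \<bullet> conic_vec x = 0})"
      using q by auto
    then show "sphere 0 1 \<inter> (\<Inter>x\<in>F. {q. q \<bullet> conic_vec x = 0}) \<noteq> {}"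
      by blast
  next
    show "closed {q. q \<bullet> conic_vec x = 0}" for x
      by (intro closed_Collect_eq continuous_intros)
  qed auto
  then obtain q where "q \<in> sphere 0 1" "\<forall>x\<in>S. q \<bullet> conic_vec x = 0"
    by blast
  then show ?thesis
    unfolding on_conic_def by (intro exI[of _ q]) auto
qed

lemma on_conic_closure:
  assumes "on_conic S" "closed K" "K \<subseteq> I" "S \<subseteq> K" "K \<subseteq> closure S"
  shows "on_conic K"
proof -
  obtain q where q: "q \<noteq> 0" "\<And>x. x \<in> S \<Longrightarrow> q \<bullet> conic_vec x = 0"
    using assms(1) unfolding on_conic_def by blast
  have "continuous_on K (\<lambda>x. q \<bullet> conic_vec x)"
    unfolding conic_vec_def
    by (intro continuous_intros continuous_on_subset[OF continuous_f assms(3)]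
        continuous_on_subset[OF continuous_g assms(3)])
  moreover have "closure S = K"
    using assms(2,4,5) by (simp add: closure_minimal subset_antisym)
  ultimately have "q \<bullet> conic_vec x = 0" if "x \<in> K" for x
    using continuous_constant_on_closure[of S "\<lambda>x. q \<bullet> conic_vec x" 0] q(2) that by simp
  then show ?thesis
    using q(1) unfolding on_conic_def by blast
qed

text \<open>Models an arithmetic progression in the parameter of a quasiarithmetic mean: there,
  means depend only on the sum of the indices.\<close>

definition M_progression :: "nat \<Rightarrow> (nat \<Rightarrow> real) \<Rightarrow> bool" where
  "M_progression N X \<longleftrightarrow> (\<forall>i\<le>N. X i \<in> I) \<and> (\<forall>i<N. X i < X (Suc i)) \<and>
    (\<forall>i\<le>N. \<forall>j\<le>N. \<forall>k\<le>N. \<forall>l\<le>N. i + j = k + l \<longrightarrow> M (X i) (X j) = M (X k) (X l))"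

lemma M_progression_in: "M_progression N X \<Longrightarrow> i \<le> N \<Longrightarrow> X i \<in> I"
  and M_progression_eq: "M_progression N X \<Longrightarrow> i \<le> N \<Longrightarrow> j \<le> N \<Longrightarrow> k \<le> N \<Longrightarrow> l \<le> N \<Longrightarrow> i + j = k + l
    \<Longrightarrow> M (X i) (X j) = M (X k) (X l)"
  and M_progression_Suc: "M_progression N X \<Longrightarrow> i < N \<Longrightarrow> X i < X (Suc i)"
  unfolding M_progression_def by blast+

lemma M_progression_less:
  assumes "M_progression N X" "i < j" "j \<le> N"
  shows "X i < X j"
  using assms(2,3)
proof (induction j)
  case (Suc j)
  then show ?case
    using M_progression_Suc[OF assms(1), of j] by (cases "i = j") auto
qed simp

text \<open>Chords of the curve joining points with equal index sum are parallel. Hence consecutive points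
  satisfy \<open>P (k + 3) = P k + \<rho> (P (k + 2) - P (k + 1))\<close> with \<open>\<rho>\<close> independent of \<open>k\<close>. In the affine
  coordinates \<open>(u, v)\<close> with \<open>P 1 = (0, 0)\<close>, \<open>P 0 = (1, 0)\<close>, \<open>P 2 = (0, 1)\<close> this says that \<open>P k\<close> is moved
  to \<open>P (k + 1)\<close> by an affine map preserving \<open>u\<^sup>2 + v\<^sup>2 - \<mu> u v - u - v\<close>, where \<open>\<mu> = \<rho> - 1\<close>.\<close>

lemma M_progression_recurrence:
  assumes X: "M_progression N X"
  obtains \<rho> where "\<And>k. k + 3 \<le> N \<Longrightarrow> f (X (k + 3)) = f (X k) + \<rho> * (f (X (k + 2)) - f (X (k + 1)))"
    "\<And>k. k + 3 \<le> N \<Longrightarrow> g (X (k + 3)) = g (X k) + \<rho> * (g (X (k + 2)) - g (X (k + 1)))"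
proof -
  have g_ne: "g (X i) \<noteq> g (X j)" if "i < j" "j \<le> N" for i j
    using M_progression_less[OF X that] M_progression_in[OF X] that inj_g
    by (metis inj_onD le_trans less_imp_le order_less_irrefl)
  have parallel: "(f (X i) - f (X j)) * (g (X k) - g (X l)) = (f (X k) - f (X l)) * (g (X i) - g (X j))"
    if "i + j = k + l" "i \<le> N" "j \<le> N" "k \<le> N" "l \<le> N" for i j k l
    using M_chord[of "X i" "X j"] M_chord[of "X k" "X l"] M_progression_eq[OF X, of i j k l]
      M_progression_in[OF X] that by simp
  \<comment> \<open>The means of two adjacent chords lie on either side of the common endpoint, so
    their slopes differ.\<close>
  have not_parallel: "(f (X (k + 1)) - f (X k)) * (g (X (k + 2)) - g (X (k + 1)))
      \<noteq> (f (X (k + 2)) - f (X (k + 1))) * (g (X (k + 1)) - g (X k))" if k: "k + 2 \<le> N" for k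
  proof -
    have mem: "X k \<in> I" "X (k + 1) \<in> I" "X (k + 2) \<in> I"
      and less: "X k < X (k + 1)" "X (k + 1) < X (k + 2)"
      using M_progression_in[OF X] M_progression_less[OF X] k by auto
    have "M (X k) (X (k + 1)) \<noteq> M (X (k + 1)) (X (k + 2))"
      using M_strict_mean(2)[of "X k" "X (k + 1)"] M_strict_mean(1)[of "X (k + 1)" "X (k + 2)"] mem less
      by linarith
    then have "\<phi> (M (X k) (X (k + 1))) \<noteq> \<phi> (M (X (k + 1)) (X (k + 2)))"
      using inj_\<phi> M_in mem by (meson inj_onD)
    moreover have "g (X k) \<noteq> g (X (k + 1))" "g (X (k + 1)) \<noteq> g (X (k + 2))"
      using g_ne k by auto
    ultimately show ?thesis
      using M_chord[OF mem(2,1)] M_chord[OF mem(3,2)] M_commute[OF mem(1,2)] M_commute[OF mem(2,3)]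
      by simp
  qed
  \<comment> \<open>With this choice the recurrence for \<open>g\<close> holds trivially; parallel
    chords with index sum \<open>2 * k + 3\<close> transfer it to \<open>f\<close>.\<close>
  define \<rho> where "\<rho> k = (g (X (k + 3)) - g (X k)) / (g (X (k + 2)) - g (X (k + 1)))" for k
  have rec_g: "g (X (k + 3)) = g (X k) + \<rho> k * (g (X (k + 2)) - g (X (k + 1)))" if "k + 3 \<le> N" for k
    using g_ne[of "k + 1" "k + 2"] that unfolding \<rho>_def by simp
  have rec_f: "f (X (k + 3)) = f (X k) + \<rho> k * (f (X (k + 2)) - f (X (k + 1)))" if "k + 3 \<le> N" for k
    using g_ne[of "k + 1" "k + 2"] parallel[of "k + 3" k "k + 2" "k + 1"] that unfolding \<rho>_def
    by (simp add: field_simps)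
  \<comment> \<open>Parallel chords with index sum \<open>2 * k + 4\<close> give, after substitution
    of both recurrences, the difference of the two factors times a nonzero determinant.\<close>
  have \<rho>_Suc: "\<rho> (k + 1) = \<rho> k" if k: "k + 4 \<le> N" for k
  proof -
    have eqs: "f (X (k + 3)) = f (X k) + \<rho> k * (f (X (k + 2)) - f (X (k + 1)))"
      "g (X (k + 3)) = g (X k) + \<rho> k * (g (X (k + 2)) - g (X (k + 1)))"
      "f (X (k + 4)) = f (X (k + 1)) + \<rho> (k + 1) * (f (X (k + 3)) - f (X (k + 2)))"
      "g (X (k + 4)) = g (X (k + 1)) + \<rho> (k + 1) * (g (X (k + 3)) - g (X (k + 2)))"
      using rec_f[of k] rec_g[of k] rec_f[of "k + 1"] rec_g[of "k + 1"] k
      by (auto simp: algebra_simps numeral_eq_Suc)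
    have "(f (X (k + 4)) - f (X k)) * (g (X (k + 3)) - g (X (k + 1)))
        = (f (X (k + 3)) - f (X (k + 1))) * (g (X (k + 4)) - g (X k))"
      using parallel[of "k + 4" k "k + 3" "k + 1"] k by simp
    moreover have "f (X k) = f (X (k + 3)) - \<rho> k * (f (X (k + 2)) - f (X (k + 1)))"
      "g (X k) = g (X (k + 3)) - \<rho> k * (g (X (k + 2)) - g (X (k + 1)))"
      using eqs by auto
    ultimately have "(\<rho> (k + 1) - \<rho> k) * ((f (X (k + 2)) - f (X (k + 1))) * (g (X (k + 3)) - g (X (k + 2)))
        - (f (X (k + 3)) - f (X (k + 2))) * (g (X (k + 2)) - g (X (k + 1)))) = 0"
      unfolding eqs(3,4) by algebra
    then show ?thesis
      using not_parallel[of "k + 1"] k by (simp add: numeral_eq_Suc)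
  qed
  have "\<rho> k = \<rho> 0" if "k + 3 \<le> N" for k
    using that
  proof (induction k)
    case (Suc k)
    then show ?case using \<rho>_Suc[of k] by simp
  qed simp
  then show ?thesis
    using that[of "\<rho> 0"] rec_f rec_g by metis
qed

lemma on_conic_M_progression:
  assumes X: "M_progression N X" and N: "2 \<le> N"
  shows "on_conic (X ` {..N})"
proof -
  obtain \<rho> where rec: "\<And>k. k + 3 \<le> N \<Longrightarrow> f (X (k + 3)) = f (X k) + \<rho> * (f (X (k + 2)) - f (X (k + 1)))"
    "\<And>k. k + 3 \<le> N \<Longrightarrow> g (X (k + 3)) = g (X k) + \<rho> * (g (X (k + 2)) - g (X (k + 1)))"
    using M_progression_recurrence[OF X] by metis
  define \<mu> where "\<mu> = \<rho> - 1"
  have mem: "X 0 \<in> I" "X 1 \<in> I" "X 2 \<in> I" and less: "X 0 < X 1" "X 1 < X 2"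
    using M_progression_in[OF X] M_progression_less[OF X] N by auto
  define d where "d = (f (X 0) - f (X 1)) * (g (X 2) - g (X 1)) - (g (X 0) - g (X 1)) * (f (X 2) - f (X 1))"
  have d: "d \<noteq> 0"
  proof -
    have "M (X 0) (X 1) \<noteq> M (X 2) (X 1)"
      using M_strict_mean(2)[of "X 0" "X 1"] M_strict_mean(1)[of "X 1" "X 2"] mem less
        M_commute[of "X 1" "X 2"] by linarith
    then have "\<phi> (M (X 0) (X 1)) \<noteq> \<phi> (M (X 2) (X 1))"
      using inj_\<phi> M_in mem by (meson inj_onD)
    moreover have "g (X 0) \<noteq> g (X 1)" "g (X 2) \<noteq> g (X 1)"
      using inj_g mem less by (auto dest: inj_onD)
    ultimately show ?thesis
      unfolding d_def M_chord[OF mem(1,2)] M_chord[OF mem(3,2)] by simp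
  qed
  \<comment> \<open>Cramer's rule for the affine frame at \<open>X 1\<close>: \<open>U\<close> and
    \<open>V\<close> need explicit coefficients so that the conic can be written in terms of
    \<open>f\<close> and \<open>g\<close>.\<close>
  define p1 p2 p3 where "p1 = (g (X 2) - g (X 1)) / d" and "p2 = - (f (X 2) - f (X 1)) / d"
    and "p3 = (g (X 1) * (f (X 2) - f (X 1)) - f (X 1) * (g (X 2) - g (X 1))) / d"
  define r1 r2 r3 where "r1 = - (g (X 0) - g (X 1)) / d" and "r2 = (f (X 0) - f (X 1)) / d"
    and "r3 = (f (X 1) * (g (X 0) - g (X 1)) - g (X 1) * (f (X 0) - f (X 1))) / d"
  define U where "U a b = p1 * a + p2 * b + p3" for a b
  define V where "V a b = r1 * a + r2 * b + r3" for a b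
  have U: "U a b = ((a - f (X 1)) * (g (X 2) - g (X 1)) - (b - g (X 1)) * (f (X 2) - f (X 1))) / d"
    and V: "V a b = ((f (X 0) - f (X 1)) * (b - g (X 1)) - (g (X 0) - g (X 1)) * (a - f (X 1))) / d" for a b
    using d unfolding U_def V_def p1_def p2_def p3_def r1_def r2_def r3_def
    by (simp_all add: field_simps)
  define u where "u k = U (f (X k)) (g (X k))" for k
  define v where "v k = V (f (X k)) (g (X k))" for k
  have base: "u 0 = 1" "v 0 = 0" "u 1 = 0" "v 1 = 0" "u 2 = 0" "v 2 = 1"
    using d unfolding u_def v_def U V by (simp_all add: d_def)
  have rec_u: "u (k + 3) = u k + \<rho> * (u (k + 2) - u (k + 1))"
    and rec_v: "v (k + 3) = v k + \<rho> * (v (k + 2) - v (k + 1))" if "k + 3 \<le> N" for k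
    using rec[OF that] unfolding u_def v_def U_def V_def by algebra+
  \<comment> \<open>The affine map sends \<open>(u, v)\<close> to
    \<open>(v, 1 - u + \<mu> * v)\<close>. Two consecutive steps are carried along because the
    recurrence links four consecutive points.\<close>
  have step: "k + 2 \<le> N \<Longrightarrow> u (k + 1) = v k \<and> v (k + 1) = 1 - u k + \<mu> * v k \<and>
      u (k + 2) = v (k + 1) \<and> v (k + 2) = 1 - u (k + 1) + \<mu> * v (k + 1)" for k
  proof (induction k)
    case 0
    then show ?case using base by (simp add: numeral_2_eq_2)
  next
    case (Suc k)
    then have IH: "u (k + 1) = v k" "v (k + 1) = 1 - u k + \<mu> * v k"
      "u (k + 2) = v (k + 1)" "v (k + 2) = 1 - u (k + 1) + \<mu> * v (k + 1)"
      by auto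
    have "u (k + 3) = u k + \<rho> * (u (k + 2) - u (k + 1))" "v (k + 3) = v k + \<rho> * (v (k + 2) - v (k + 1))"
      using rec_u[of k] rec_v[of k] Suc.prems by auto
    then have "u (k + 3) = v (k + 2)" "v (k + 3) = 1 - u (k + 2) + \<mu> * v (k + 2)"
      using IH \<mu>_def by algebra+
    then show ?case
      using IH by (simp add: numeral_eq_Suc)
  qed
  \<comment> \<open>For the last step \<open>step\<close> itself is out of range, and its second
    half at \<open>k - 1\<close> is used.\<close>
  have step1: "u (Suc k) = v k \<and> v (Suc k) = 1 - u k + \<mu> * v k" if "Suc k \<le> N" for k
  proof (cases "k + 2 \<le> N")
    case True
    then show ?thesis using step[of k] by simp
  next
    case False
    then have "k = Suc (k - 1)" "k - 1 + 2 \<le> N"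
      using that N by auto
    then show ?thesis
      using step[of "k - 1"] by (metis Suc_eq_plus1 add_2_eq_Suc')
  qed
  define Q where "Q a b = a\<^sup>2 + b\<^sup>2 - \<mu> * a * b - a - b" for a b :: real
  have Q0: "Q (u k) (v k) = 0" if "k \<le> N" for k
    using that
  proof (induction k)
    case 0
    then show ?case using base by (simp add: Q_def)
  next
    case (Suc k)
    have "Q (v k) (1 - u k + \<mu> * v k) = Q (u k) (v k)"
      unfolding Q_def by algebra
    then show ?case
      using Suc step1 by simp
  qed
  \<comment> \<open>The coefficients of \<open>Q (U a b) (V a b)\<close> as a polynomial in
    \<open>a\<close> and \<open>b\<close>.\<close>
  define q where "q = (p1\<^sup>2 + r1\<^sup>2 - \<mu> * p1 * r1, 2 * p1 * p2 + 2 * r1 * r2 - \<mu> * (p1 * r2 + p2 * r1),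
    p2\<^sup>2 + r2\<^sup>2 - \<mu> * p2 * r2, 2 * p1 * p3 + 2 * r1 * r3 - \<mu> * (p1 * r3 + p3 * r1) - p1 - r1,
    2 * p2 * p3 + 2 * r2 * r3 - \<mu> * (p2 * r3 + p3 * r2) - p2 - r2, p3\<^sup>2 + r3\<^sup>2 - \<mu> * p3 * r3 - p3 - r3)"
  have q: "q \<bullet> (a\<^sup>2, a * b, b\<^sup>2, a, b, 1) = Q (U a b) (V a b)" for a b
    unfolding q_def Q_def U_def V_def inner_Pair inner_real_def by algebra
  have "q \<noteq> 0"
  proof
    \<comment> \<open>The point with affine coordinates (2, 0), where \<open>Q\<close> has the value
      2.\<close>
    define a where "a = 2 * f (X 0) - f (X 1)"
    define b where "b = 2 * g (X 0) - g (X 1)"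
    have "U a b = 2 * u 0 - u 1" "V a b = 2 * v 0 - v 1"
      unfolding a_def b_def u_def v_def U_def V_def by (simp_all add: algebra_simps)
    then have "Q (U a b) (V a b) = 2"
      using base by (simp add: Q_def)
    moreover assume "q = 0"
    ultimately show False
      using q[of a b] by simp
  qed
  moreover have "q \<bullet> conic_vec (X k) = 0" if "k \<le> N" for k
    using Q0[OF that] q unfolding conic_vec_def u_def v_def by simp
  ultimately show ?thesis
    unfolding on_conic_def by blast
qed

section \<open>Dyadic refinement of progressions under bisymmetry\<close>

definition M_bisymmetric :: bool where
  "M_bisymmetric \<longleftrightarrow> (\<forall>x\<in>I. \<forall>y\<in>I. \<forall>u\<in>I. \<forall>v\<in>I. M (M x y) (M u v) = M (M x u) (M y v))"

text \<open>The index is split as evenly as possible: even indices reproduce \<open>X\<close>, odd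
  ones insert the mean of two neighbours.\<close>

definition M_refine :: "(nat \<Rightarrow> real) \<Rightarrow> nat \<Rightarrow> real" where
  "M_refine X m = M (X (m div 2)) (X (m - m div 2))"

lemma M_refine_double [simp]: "M_refine X (2 * i) = X i"
  by (simp add: M_refine_def)

lemma M_refine_eq:
  assumes "M_progression N X" "i \<le> N" "j \<le> N"
  shows "M_refine X (i + j) = M (X i) (X j)"
  unfolding M_refine_def using assms(2,3) by (intro M_progression_eq[OF assms(1)]) auto

text \<open>Bisymmetry regroups a mean of two means so that the index sums of the inner ones become
  the balanced halves of \<open>m + n\<close>; the result thus depends on \<open>m + n\<close>
  alone.\<close>

lemma M_progression_refine:
  assumes X: "M_progression N X" and bis: M_bisymmetric
  shows "M_progression (2 * N) (M_refine X)"
proof -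
  have mid: "M (M_refine X m) (M_refine X n) = M (M_refine X ((m + n) div 2)) (M_refine X ((m + n) - (m + n) div 2))"
    if mn: "m \<le> 2 * N" "n \<le> 2 * N" for m n
  proof -
    define i j where "i = m div 2" and "j = m - m div 2"
    \<comment> \<open>\<open>k\<close> is the smaller half of \<open>n\<close>, except when
      \<open>m\<close> and \<open>n\<close> are both odd: then the larger half compensates for the
      rounding in \<open>i\<close>.\<close>
    obtain k l where kl: "k + l = n" "i + k = (m + n) div 2" "j + l = (m + n) - (m + n) div 2"
      "k \<le> N" "l \<le> N"
    proof (cases "even m \<or> even n")
      case True
      then have "m div 2 + n div 2 = (m + n) div 2"
        by (auto elim!: evenE)
      moreover have "n - n div 2 \<le> N" "n div 2 \<le> N"
        using mn by presburger+
      ultimately show ?thesis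
        using that[of "n div 2" "n - n div 2"] unfolding i_def j_def by linarith
    next
      case False
      then have "m div 2 + (n - n div 2) = (m + n) div 2"
        by (auto elim!: oddE)
      moreover have "n - n div 2 \<le> N" "n div 2 \<le> N"
        using mn by presburger+
      ultimately show ?thesis
        using that[of "n - n div 2" "n div 2"] unfolding i_def j_def by linarith
    qed
    have ij: "i + j = m" "i \<le> N" "j \<le> N"
      using mn unfolding i_def j_def by auto
    have "M (M_refine X m) (M_refine X n) = M (M (X i) (X j)) (M (X k) (X l))"
      using M_refine_eq[OF X ij(2,3)] M_refine_eq[OF X kl(4,5)] ij kl by simp
    also have "\<dots> = M (M (X i) (X k)) (M (X j) (X l))"
      using bis M_progression_in[OF X] ij kl unfolding M_bisymmetric_def by blast
    also have "\<dots> = M (M_refine X (i + k)) (M_refine X (j + l))"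
      using M_refine_eq[OF X ij(2) kl(4)] M_refine_eq[OF X ij(3) kl(5)] by simp
    finally show ?thesis
      using kl by simp
  qed
  have "M_refine X i \<in> I" if "i \<le> 2 * N" for i
    unfolding M_refine_def using that M_progression_in[OF X] by (intro M_in) auto
  moreover have "M_refine X i < M_refine X (Suc i)" if i: "i < 2 * N" for i
  proof (cases "even i")
    case True
    then obtain k where k: "i = 2 * k" by blast
    then have "X k < M (X k) (X (Suc k))"
      using i M_progression_in[OF X] M_progression_Suc[OF X] by (intro M_strict_mean) auto
    moreover have "M_refine X (Suc i) = M (X k) (X (Suc k))"
      using M_refine_eq[OF X, of k "Suc k"] i k by (simp add: mult_2)
    ultimately show ?thesis
      using k by simp
  next
    case False
    then obtain k where k: "i = 2 * k + 1" by (auto elim: oddE)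
    then have "M (X k) (X (Suc k)) < X (Suc k)"
      using i M_progression_in[OF X] M_progression_Suc[OF X] by (intro M_strict_mean) auto
    moreover have "M_refine X i = M (X k) (X (Suc k))"
      using M_refine_eq[OF X, of k "Suc k"] i k by (simp add: mult_2)
    moreover have "M_refine X (Suc i) = X (Suc k)"
      using M_refine_double[of X "Suc k"] k by simp
    ultimately show ?thesis
      by simp
  qed
  moreover have "M (M_refine X i) (M_refine X j) = M (M_refine X k) (M_refine X l)"
    if "i \<le> 2 * N" "j \<le> 2 * N" "k \<le> 2 * N" "l \<le> 2 * N" "i + j = k + l" for i j k l
    using mid[of i j] mid[of k l] that by simp
  ultimately show ?thesis
    unfolding M_progression_def by blast
qed

fun dyadic :: "real \<Rightarrow> real \<Rightarrow> nat \<Rightarrow> nat \<Rightarrow> real" where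
  "dyadic a b 0 = (\<lambda>i. if i = 0 then a else b)"
| "dyadic a b (Suc n) = M_refine (dyadic a b n)"

lemma M_progression_dyadic:
  assumes "a \<in> I" "b \<in> I" "a < b" M_bisymmetric
  shows "M_progression (2 ^ n) (dyadic a b n)"
proof (induction n)
  case 0
  \<comment> \<open>With two points, equal index sums determine the unordered pair, so symmetry of
    \<open>M\<close> suffices.\<close>
  have "{i, j} = {k, l}" if "i \<le> 1" "j \<le> 1" "k \<le> 1" "l \<le> 1" "i + j = k + l" for i j k l :: nat
    using that by (cases i; cases j; cases k; cases l) auto
  then show ?case
    using assms(1-3) M_commute unfolding M_progression_def
    by (auto simp: doubleton_eq_iff le_Suc_eq)
next
  case (Suc n)
  then show ?case
    using M_progression_refine assms(4) by simp
qed

definition dyadic_level :: "real \<Rightarrow> real \<Rightarrow> nat \<Rightarrow> real set" where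
  "dyadic_level a b n = dyadic a b n ` {..2 ^ n}"

lemma dyadic_level_mono:
  assumes "m \<le> n"
  shows "dyadic_level a b m \<subseteq> dyadic_level a b n"
proof -
  have "dyadic_level a b k \<subseteq> dyadic_level a b (Suc k)" for k
  proof
    fix x assume "x \<in> dyadic_level a b k"
    then obtain i where "i \<le> 2 ^ k" "x = dyadic a b k i"
      unfolding dyadic_level_def by auto
    then have "2 * i \<le> 2 ^ Suc k" "x = dyadic a b (Suc k) (2 * i)"
      by auto
    then show "x \<in> dyadic_level a b (Suc k)"
      unfolding dyadic_level_def by blast
  qed
  then show ?thesis
    by (rule lift_Suc_mono_le[OF _ assms])
qed

lemma on_conic_dyadic:
  assumes "a \<in> I" "b \<in> I" "a < b" M_bisymmetric
  shows "on_conic (\<Union>n. dyadic_level a b n)"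
proof (rule on_conic_if_finite_subsets)
  fix F assume "finite F" "F \<subseteq> (\<Union>n. dyadic_level a b n)"
  then have "\<exists>n. F \<subseteq> dyadic_level a b n"
  proof (induction F rule: finite_induct)
    case (insert x F)
    then obtain m n where "F \<subseteq> dyadic_level a b m" "x \<in> dyadic_level a b n"
      by blast
    then have "insert x F \<subseteq> dyadic_level a b (max m n)"
      using dyadic_level_mono[of m "max m n" a b] dyadic_level_mono[of n "max m n" a b] by auto
    then show ?case
      by blast
  qed simp
  then obtain n where "F \<subseteq> dyadic_level a b n"
    by blast
  \<comment> \<open>Level 0 has only two points, while \<open>on_conic_M_progression\<close> asks
    for at least three; one further refinement ensures this.\<close>
  then have "F \<subseteq> dyadic_level a b (Suc n)"
    using dyadic_level_mono[of n "Suc n" a b] by auto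
  moreover have "on_conic (dyadic_level a b (Suc n))"
    unfolding dyadic_level_def
    by (rule on_conic_M_progression[OF M_progression_dyadic[OF assms]]) simp
  ultimately show "on_conic F"
    by (rule on_conic_subset[rotated])
qed

text \<open>On a common level the points have indices \<open>i\<close> and \<open>j\<close>, and
  their mean has index \<open>i + j\<close> one level further.\<close>

lemma M_dyadic:
  assumes "a \<in> I" "b \<in> I" "a < b" M_bisymmetric
    and "x \<in> (\<Union>n. dyadic_level a b n)" "y \<in> (\<Union>n. dyadic_level a b n)"
  shows "M x y \<in> (\<Union>n. dyadic_level a b n)"
proof -
  obtain m n where "x \<in> dyadic_level a b m" "y \<in> dyadic_level a b n"
    using assms(5,6) by blast
  then have "x \<in> dyadic_level a b (max m n)" "y \<in> dyadic_level a b (max m n)"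
    using dyadic_level_mono[of m "max m n" a b] dyadic_level_mono[of n "max m n" a b] by auto
  then obtain i j where ij: "i \<le> 2 ^ max m n" "j \<le> 2 ^ max m n"
      "x = dyadic a b (max m n) i" "y = dyadic a b (max m n) j"
    unfolding dyadic_level_def by auto
  then have "M x y = dyadic a b (Suc (max m n)) (i + j)"
    using M_refine_eq[OF M_progression_dyadic[OF assms(1-4)]] by simp
  moreover have "i + j \<le> 2 ^ Suc (max m n)"
    using ij by simp
  ultimately show ?thesis
    unfolding dyadic_level_def by blast
qed

text \<open>A gap of the closure would contain the mean of its endpoints, whereas the means of nearby points
  of \<open>D\<close> stay outside the gap.\<close>

lemma dense_if_closed_under_M:
  assumes ab: "a \<in> I" "b \<in> I" "a < b" and D: "D \<subseteq> {a..b}" "a \<in> D" "b \<in> D"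
    and M_D: "\<And>x y. x \<in> D \<Longrightarrow> y \<in> D \<Longrightarrow> M x y \<in> D"
  shows "{a..b} \<subseteq> closure D"
proof (rule ccontr)
  assume "\<not> {a..b} \<subseteq> closure D"
  then obtain t where "t \<in> {a..b}" "t \<notin> closure D"
    by blast
  then have t: "a \<le> t" "t \<le> b" "t \<notin> closure D"
    by auto
  have sub: "{a..b} \<subseteq> I"
    by (auto intro: mem_I_between[OF ab(1,2)])
  have cl: "closure D \<subseteq> {a..b}"
    using D(1) by (simp add: closure_minimal)
  define p where "p = Sup (closure D \<inter> {..t})"
  define q where "q = Inf (closure D \<inter> {t..})"
  have a_cl: "a \<in> closure D" and b_cl: "b \<in> closure D"
    using D closure_subset by blast+
  have bdd: "bdd_above (closure D \<inter> {..t})" "bdd_below (closure D \<inter> {t..})"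
    by auto
  have "p \<in> closure D \<inter> {..t}" unfolding p_def
    using a_cl t bdd by (intro closed_contains_Sup closed_Int closed_closure closed_atMost) auto
  moreover have "q \<in> closure D \<inter> {t..}" unfolding q_def
    using b_cl t bdd by (intro closed_contains_Inf closed_Int closed_closure closed_atLeast) auto
  ultimately have pq: "p \<in> closure D" "q \<in> closure D" "p < t" "t < q"
    using t(3) by (auto simp: order_less_le)
  have gap: "x \<le> p \<or> q \<le> x" if "x \<in> D" for x
  proof (cases "x \<le> t")
    case True
    then have "x \<in> closure D \<inter> {..t}"
      using subsetD[OF closure_subset that] by auto
    then have "x \<le> p"
      unfolding p_def by (rule cSup_upper[OF _ bdd(1)])
    then show ?thesis ..
  next
    case False
    then have "x \<in> closure D \<inter> {t..}"
      using subsetD[OF closure_subset that] by auto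
    then have "q \<le> x"
      unfolding q_def by (rule cInf_lower[OF _ bdd(2)])
    then show ?thesis ..
  qed
  have pqI: "p \<in> I" "q \<in> I" "p < q"
    using pq cl sub by auto
  obtain P Q where P: "\<And>n. P n \<in> D" "P \<longlonglongrightarrow> p" and Q: "\<And>n. Q n \<in> D" "Q \<longlonglongrightarrow> q"
    using pq(1,2) unfolding closure_sequential by blast
  have DI: "x \<in> I" if "x \<in> D" for x
    using that D(1) sub by blast
  define m where "m = M p q"
  have m: "p < m" "m < q" "m \<in> I" "f p - f q = \<phi> m * (g p - g q)"
    using M_strict_mean[OF pqI] unfolding m_def by auto
  have f_lim: "(\<lambda>n. f (S n)) \<longlonglongrightarrow> f s" and g_lim: "(\<lambda>n. g (S n)) \<longlonglongrightarrow> g s"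
    if "S \<longlonglongrightarrow> s" "s \<in> I" for S s
    using isCont_tendsto_compose[OF DERIV_isCont[OF Df[OF that(2)]] that(1)]
      isCont_tendsto_compose[OF DERIV_isCont[OF Dg[OF that(2)]] that(1)] by auto
  have g_ne: "g p \<noteq> g q"
    using inj_g pqI by (auto dest: inj_onD)
  \<comment> \<open>Convergence of the means is expressed through slopes: those of the approximating
    chords tend to the slope over \<open>p\<close> and \<open>q\<close>, which is
    \<open>\<phi> m\<close>.\<close>
  have "(\<lambda>n. (f (P n) - f (Q n)) / (g (P n) - g (Q n))) \<longlonglongrightarrow> (f p - f q) / (g p - g q)"
    using g_ne by (intro tendsto_intros f_lim g_lim P Q pqI) auto
  moreover have "(f p - f q) / (g p - g q) = \<phi> m"
    using m(4) g_ne by simp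
  moreover have "eventually (\<lambda>n. (f (P n) - f (Q n)) / (g (P n) - g (Q n)) = \<phi> (M (P n) (Q n))) sequentially"
  proof -
    have "(\<lambda>n. g (P n) - g (Q n)) \<longlonglongrightarrow> g p - g q"
      by (intro tendsto_intros g_lim P Q pqI)
    then have "eventually (\<lambda>n. g (P n) - g (Q n) \<noteq> 0) sequentially"
      by (rule tendsto_imp_eventually_ne) (use g_ne in simp)
    then show ?thesis
      by eventually_elim (use M_chord DI P Q in simp)
  qed
  ultimately have lim: "(\<lambda>n. \<phi> (M (P n) (Q n))) \<longlonglongrightarrow> \<phi> m"
    by (simp cong: filterlim_cong)
  obtain \<sigma> where \<sigma>: "\<And>x y. x \<in> I \<Longrightarrow> y \<in> I \<Longrightarrow> x < y \<Longrightarrow> \<sigma> * \<phi> x < \<sigma> * \<phi> y"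
    using strictly_monotone_on_signE[OF strictly_monotone_\<phi>] by blast
  have "(\<lambda>n. \<sigma> * \<phi> (M (P n) (Q n))) \<longlonglongrightarrow> \<sigma> * \<phi> m"
    by (intro tendsto_intros lim)
  then have "eventually (\<lambda>n. \<sigma> * \<phi> p < \<sigma> * \<phi> (M (P n) (Q n))) sequentially"
    "eventually (\<lambda>n. \<sigma> * \<phi> (M (P n) (Q n)) < \<sigma> * \<phi> q) sequentially"
    using order_tendstoD \<sigma>[OF pqI(1) m(3,1)] \<sigma>[OF m(3) pqI(2) m(2)] by blast+
  then have "eventually (\<lambda>n. False) sequentially"
  proof eventually_elim
    case (elim n)
    have "M (P n) (Q n) \<in> D"
      using M_D P Q by blast
    then show ?case
      using gap[of "M (P n) (Q n)"] DI[of "M (P n) (Q n)"] \<sigma>[of "M (P n) (Q n)" p]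
        \<sigma>[of q "M (P n) (Q n)"] pqI elim by force
  qed
  then show False
    by simp
qed

lemma on_conic_interval:
  assumes ab: "a \<in> I" "b \<in> I" "a < b" and bis: M_bisymmetric
  shows "on_conic {a..b}"
proof (rule on_conic_closure[OF on_conic_dyadic[OF assms]])
  let ?D = "\<Union>n. dyadic_level a b n"
  have end0: "dyadic a b n 0 = a" for n
    by (induction n) (auto simp: M_refine_def)
  have end1: "dyadic a b n (2 ^ n) = b" for n
    by (induction n) auto
  have "dyadic a b n i \<in> {a..b}" if i: "i \<le> 2 ^ n" for n i
  proof -
    note less = M_progression_less[OF M_progression_dyadic[OF assms, of n]]
    show ?thesis
      using less[of 0 i] less[of i "2 ^ n"] i end0[of n] end1[of n]
      by (cases "i = 0"; cases "i = 2 ^ n") auto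
  qed
  then show D: "?D \<subseteq> {a..b}"
    unfolding dyadic_level_def by auto
  have "a \<in> dyadic_level a b 0" "b \<in> dyadic_level a b 0"
    unfolding dyadic_level_def by (auto simp: image_iff intro: exI[of _ "Suc 0"])
  then show "{a..b} \<subseteq> closure ?D"
    using D by (intro dense_if_closed_under_M[OF ab] M_dyadic[OF assms]) blast+
  show "{a..b} \<subseteq> I"
    by (auto intro: mem_I_between[OF ab(1,2)])
qed auto

text \<open>The conic found for a compact subinterval may depend on it; a second use of compactness
  yields one conic for all of \<open>I\<close>.\<close>

lemma on_conic_I:
  assumes M_bisymmetric
  shows "on_conic I"
proof (rule on_conic_if_finite_subsets)
  fix F assume F: "finite F" "F \<subseteq> I"
  obtain x where x: "x \<in> I" using I_ne by blast
  obtain e where e: "e > 0" "ball x e \<subseteq> I"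
    using openE[OF I_open x] by blast
  define y where "y = x + e / 2"
  have y: "y \<in> I" "x < y"
    using e unfolding y_def by (auto simp: subset_eq dist_real_def)
  \<comment> \<open>The two extra points make the interval nondegenerate even if \<open>F\<close>
    has fewer than two elements.\<close>
  define G where "G = insert x (insert y F)"
  have G: "finite G" "G \<subseteq> I" "x \<in> G" "y \<in> G" "G \<noteq> {}"
    using F x y unfolding G_def by auto
  have "Min G \<in> I" "Max G \<in> I" "Min G < Max G"
    using G(2) Min_in[OF G(1,5)] Max_in[OF G(1,5)] Min_le[OF G(1,3)] Max_ge[OF G(1,4)] y(2) by auto
  then have "on_conic {Min G..Max G}"
    by (rule on_conic_interval[OF _ _ _ assms])
  moreover have "F \<subseteq> {Min G..Max G}"
  proof
    fix z assume "z \<in> F"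
    then have "z \<in> G" by (simp add: G_def)
    then show "z \<in> {Min G..Max G}"
      using Min_le[OF G(1)] Max_ge[OF G(1)] by auto
  qed
  ultimately show "on_conic F"
    by (rule on_conic_subset)
qed

definition conic_relation :: "real \<Rightarrow> real \<Rightarrow> real \<Rightarrow> real \<Rightarrow> real \<Rightarrow> real \<Rightarrow> bool" where
  "conic_relation \<alpha> \<beta> \<gamma> \<delta> \<epsilon> \<eta> \<longleftrightarrow> (\<alpha>, \<beta>, \<gamma>) \<noteq> (0, 0, 0) \<and>
    (\<forall>x\<in>I. \<alpha> * (f x)\<^sup>2 + \<beta> * f x * g x + \<gamma> * (g x)\<^sup>2 + \<delta> * f x + \<epsilon> * g x + \<eta> = 0)"

lemma conic_relation_if_bisymmetric:
  assumes M_bisymmetric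
  shows "\<exists>\<alpha> \<beta> \<gamma> \<delta> \<epsilon> \<eta>. conic_relation \<alpha> \<beta> \<gamma> \<delta> \<epsilon> \<eta>"
proof -
  obtain q where q: "q \<noteq> 0" "\<And>x. x \<in> I \<Longrightarrow> q \<bullet> conic_vec x = 0"
    using on_conic_I[OF assms] unfolding on_conic_def by blast
  obtain \<alpha> \<beta> \<gamma> \<delta> \<epsilon> \<eta> where q_eq: "q = (\<alpha>, \<beta>, \<gamma>, \<delta>, \<epsilon>, \<eta>)"
    by (metis prod_cases6)
  have rel: "\<alpha> * (f x)\<^sup>2 + \<beta> * f x * g x + \<gamma> * (g x)\<^sup>2 + \<delta> * f x + \<epsilon> * g x + \<eta> = 0" if "x \<in> I" for x
    using q(2)[OF that] unfolding q_eq conic_vec_def by (simp add: algebra_simps)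
  have "(\<alpha>, \<beta>, \<gamma>) \<noteq> (0, 0, 0)"
  proof
    assume "(\<alpha>, \<beta>, \<gamma>) = (0, 0, 0)"
    then have "q = 0"
      using not_on_line[of \<delta> \<epsilon> \<eta>] rel q_eq by (simp add: zero_prod_def)
    then show False
      using q(1) by simp
  qed
  then show ?thesis
    using rel unfolding conic_relation_def by blast
qed

subsection \<open>A curve on a conic has a quasiarithmetic Cauchy mean\<close>

context
  fixes \<alpha> \<beta> \<gamma> \<delta> \<epsilon> \<eta> :: real
  assumes conic: "conic_relation \<alpha> \<beta> \<gamma> \<delta> \<epsilon> \<eta>"
begin

text \<open>The partial derivatives of the conic polynomial with respect to \<open>f\<close> and
  \<open>g\<close>, along the curve.\<close>

definition A :: "real \<Rightarrow> real" where "A x = 2 * \<alpha> * f x + \<beta> * g x + \<delta>"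
definition B :: "real \<Rightarrow> real" where "B x = \<beta> * f x + 2 * \<gamma> * g x + \<epsilon>"

lemma conic_eq:
  "x \<in> I \<Longrightarrow> \<alpha> * (f x)\<^sup>2 + \<beta> * f x * g x + \<gamma> * (g x)\<^sup>2 + \<delta> * f x + \<epsilon> * g x + \<eta> = 0"
  using conic unfolding conic_relation_def by blast

lemma DA: "x \<in> I \<Longrightarrow> (A has_real_derivative 2 * \<alpha> * deriv f x + \<beta> * deriv g x) (at x)"
  unfolding A_def[abs_def] by (rule D_affine)

lemma DB: "x \<in> I \<Longrightarrow> (B has_real_derivative \<beta> * deriv f x + 2 * \<gamma> * deriv g x) (at x)"
  unfolding B_def[abs_def] by (rule D_affine)

lemma tangent:
  assumes x: "x \<in> I"
  shows "A x * deriv f x + B x * deriv g x = 0"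
proof (rule deriv_zero_if_constant_on_open[OF I_open x conic_eq])
  show "((\<lambda>x. \<alpha> * (f x)\<^sup>2 + \<beta> * f x * g x + \<gamma> * (g x)\<^sup>2 + \<delta> * f x + \<epsilon> * g x + \<eta>)
      has_real_derivative A x * deriv f x + B x * deriv g x) (at x)"
    unfolding A_def B_def power2_eq_square
    by (rule DERIV_cong,
        (rule DERIV_add DERIV_const DERIV_cmult Df[OF x] Dg[OF x] DERIV_mult)+) (simp add: algebra_simps)
qed

lemma tangent_\<phi>: "x \<in> I \<Longrightarrow> A x * \<phi> x + B x = 0"
proof -
  assume x: "x \<in> I"
  have "(A x * \<phi> x + B x) * deriv g x = 0"
    using tangent[OF x] unfolding deriv_f_eq[OF x] by (simp add: algebra_simps)
  then show ?thesis
    using deriv_g_nonzero[OF x] by simp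
qed

text \<open>A singular point of the conic on the curve would confine the slopes of the chords through it to
  the at most two roots of \<open>\<alpha> s\<^sup>2 + \<beta> s + \<gamma>\<close>.\<close>

lemma A_nonzero:
  assumes x: "x \<in> I"
  shows "A x \<noteq> 0"
proof
  assume A0: "A x = 0"
  then have B0: "B x = 0"
    using tangent_\<phi>[OF x] by simp
  have root: "\<alpha> * (\<phi> (M x y))\<^sup>2 + \<beta> * \<phi> (M x y) + \<gamma> = 0" if y: "y \<in> I" "x < y" for y
  proof -
    define s where "s = \<phi> (M x y)"
    have g: "g x \<noteq> g y"
      using inj_g x y by (auto dest: inj_onD)
    have "f y - f x = s * (g y - g x)"
      using M_chord[OF x y(1)] unfolding s_def by (simp add: algebra_simps)
    \<comment> \<open>Taylor expansion at \<open>x\<close>, exact in degree two, with vanishing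
      linear part.\<close>
    moreover have "\<alpha> * (f y - f x)\<^sup>2 + \<beta> * (f y - f x) * (g y - g x) + \<gamma> * (g y - g x)\<^sup>2 = 0"
    proof -
      have "\<alpha> * (f y - f x)\<^sup>2 + \<beta> * (f y - f x) * (g y - g x) + \<gamma> * (g y - g x)\<^sup>2
        = (\<alpha> * (f y)\<^sup>2 + \<beta> * f y * g y + \<gamma> * (g y)\<^sup>2 + \<delta> * f y + \<epsilon> * g y + \<eta>)
        - (\<alpha> * (f x)\<^sup>2 + \<beta> * f x * g x + \<gamma> * (g x)\<^sup>2 + \<delta> * f x + \<epsilon> * g x + \<eta>)
        - A x * (f y - f x) - B x * (g y - g x)"
        unfolding A_def B_def by algebra
      then show ?thesis
        unfolding conic_eq[OF x] conic_eq[OF y(1)] A0 B0 by simp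
    qed
    ultimately have "\<alpha> * (s * (g y - g x))\<^sup>2 + \<beta> * (s * (g y - g x)) * (g y - g x) + \<gamma> * (g y - g x)\<^sup>2 = 0"
      by (simp only:)
    then have "(\<alpha> * s\<^sup>2 + \<beta> * s + \<gamma>) * (g x - g y)\<^sup>2 = 0"
      by algebra
    then show ?thesis
      using g unfolding s_def by simp
  qed
  obtain e where e: "e > 0" "ball x e \<subseteq> I"
    using openE[OF I_open x] by blast
  define y where "y = x + e / 2"
  have y: "y \<in> I" "x < y"
    using e unfolding y_def by (auto simp: subset_eq dist_real_def)
  \<comment> \<open>Iterated means produce three distinct slopes, too many roots for a nonzero
    quadratic polynomial.\<close>
  define y1 where "y1 = M x y"
  have y1: "y1 \<in> I" "x < y1" "y1 < y"
    using M_strict_mean[OF x y] unfolding y1_def by auto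
  define y2 where "y2 = M x y1"
  have y2: "y2 \<in> I" "x < y2" "y2 < y1"
    using M_strict_mean[OF x y1(1,2)] unfolding y2_def by auto
  define y3 where "y3 = M x y2"
  have y3: "y3 \<in> I" "x < y3" "y3 < y2"
    using M_strict_mean[OF x y2(1,2)] unfolding y3_def by auto
  have ne: "\<phi> y1 \<noteq> \<phi> y2" "\<phi> y1 \<noteq> \<phi> y3" "\<phi> y2 \<noteq> \<phi> y3"
    using inj_on_eq_iff[OF inj_\<phi>] y1 y2 y3 by auto
  have r: "\<alpha> * (\<phi> y1)\<^sup>2 + \<beta> * \<phi> y1 + \<gamma> = 0" "\<alpha> * (\<phi> y2)\<^sup>2 + \<beta> * \<phi> y2 + \<gamma> = 0"
    "\<alpha> * (\<phi> y3)\<^sup>2 + \<beta> * \<phi> y3 + \<gamma> = 0"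
    using root[OF y] root[OF y1(1,2)] root[OF y2(1,2)] unfolding y1_def y2_def y3_def by auto
  have "(\<phi> y1 - \<phi> y2) * (\<alpha> * (\<phi> y1 + \<phi> y2) + \<beta>) = 0"
    using r(1,2) by algebra
  then have 1: "\<alpha> * (\<phi> y1 + \<phi> y2) + \<beta> = 0" using ne(1) by simp
  have "(\<phi> y1 - \<phi> y3) * (\<alpha> * (\<phi> y1 + \<phi> y3) + \<beta>) = 0"
    using r(1,3) by algebra
  then have 2: "\<alpha> * (\<phi> y1 + \<phi> y3) + \<beta> = 0" using ne(2) by simp
  have "\<alpha> * (\<phi> y2 - \<phi> y3) = 0"
    using 1 2 by algebra
  then have "\<alpha> = 0" using ne(3) by simp
  moreover from this have "\<beta> = 0" using 1 by simp
  moreover from calculation have "\<gamma> = 0" using r(1) by simp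
  ultimately show False
    using conic unfolding conic_relation_def by simp
qed

lemma continuous_A: "continuous_on I A"
  unfolding A_def[abs_def] by (intro continuous_intros continuous_f continuous_g)

lemma A_sum_nonzero:
  assumes "x \<in> I" "y \<in> I"
  shows "A x + A y \<noteq> 0"
proof -
  have "sgn (A x) = sgn (A y)"
    by (rule sgn_eq_if_nonzero_on_interval[OF I_int continuous_A A_nonzero assms])
  then show ?thesis
    using A_nonzero[OF assms(1)] by (auto simp: sgn_real_def split: if_splits)
qed

text \<open>For a quadratic polynomial the trapezoidal rule applied to the gradient is exact, and
  both endpoint values vanish.\<close>

lemma conic_chord:
  assumes "x \<in> I" "y \<in> I"
  shows "(A x + A y) * (f x - f y) + (B x + B y) * (g x - g y) = 0"
proof -
  have "(A x + A y) * (f x - f y) + (B x + B y) * (g x - g y)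
    = 2 * (\<alpha> * (f x)\<^sup>2 + \<beta> * f x * g x + \<gamma> * (g x)\<^sup>2 + \<delta> * f x + \<epsilon> * g x + \<eta>)
    - 2 * (\<alpha> * (f y)\<^sup>2 + \<beta> * f y * g y + \<gamma> * (g y)\<^sup>2 + \<delta> * f y + \<epsilon> * g y + \<eta>)"
    unfolding A_def B_def by algebra
  then show ?thesis
    unfolding conic_eq[OF assms(1)] conic_eq[OF assms(2)] by simp
qed

text \<open>The derivative is \<open>4 * \<alpha> * \<gamma> - \<beta>\<^sup>2\<close> times the
  left side of \<open>tangent\<close>. The constant later relates \<open>W\<close> to the cube of
  \<open>g' / A\<close>.\<close>

lemma conic_disc_constant:
  assumes "x \<in> I" "y \<in> I"
  shows "\<alpha> * (B x)\<^sup>2 - \<beta> * (A x * B x) + \<gamma> * (A x)\<^sup>2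
    = \<alpha> * (B y)\<^sup>2 - \<beta> * (A y * B y) + \<gamma> * (A y)\<^sup>2"
proof (rule constant_if_deriv_zero_on_interval[OF I_int _ assms])
  fix t assume t: "t \<in> I"
  note A' = DA[OF t] and B' = DB[OF t]
  show "((\<lambda>t. \<alpha> * (B t)\<^sup>2 - \<beta> * (A t * B t) + \<gamma> * (A t)\<^sup>2) has_real_derivative 0) (at t)"
    unfolding power2_eq_square
    by (rule DERIV_cong, (rule DERIV_add DERIV_diff DERIV_cmult A' B' DERIV_mult)+)
      (use tangent[OF t] in algebra)
qed

lemma quadratic_form_deriv:
  assumes x: "x \<in> I"
  shows "(A x)\<^sup>2 * (\<alpha> * (deriv f x)\<^sup>2 + \<beta> * deriv f x * deriv g x + \<gamma> * (deriv g x)\<^sup>2)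
    = (deriv g x)\<^sup>2 * (\<alpha> * (B x)\<^sup>2 - \<beta> * (A x * B x) + \<gamma> * (A x)\<^sup>2)"
  using tangent[OF x] by algebra

section \<open>The parameter \<open>h\<close>, with respect to which the curve has velocity
  \<open>(- B, A)\<close> for \<open>(f, g)\<close>\<close>

context
  fixes h H :: "real \<Rightarrow> real"
  assumes h: "\<And>x. x \<in> I \<Longrightarrow> (h has_real_derivative H x) (at x)"
    and H: "\<And>x. x \<in> I \<Longrightarrow> deriv g x = A x * H x"
begin

lemma deriv_f_eq_conic: "x \<in> I \<Longrightarrow> deriv f x = - B x * H x"
proof -
  assume x: "x \<in> I"
  have "A x * (deriv f x + B x * H x) = 0"
    using tangent[OF x] H[OF x] by algebra
  then show ?thesis
    using A_nonzero[OF x] by simp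
qed

lemma H_nonzero: "x \<in> I \<Longrightarrow> H x \<noteq> 0"
  using H[of x] deriv_g_nonzero[of x] by auto

text \<open>As functions of \<open>h\<close>, both \<open>A\<close> and \<open>B\<close> solve \<open>e'' = (\<beta>\<^sup>2 - 4 \<alpha> \<gamma>) e\<close>.\<close>

lemma \<phi>_midpoint:
  assumes xyz: "x \<in> I" "y \<in> I" "z \<in> I" "h z = (h x + h y) / 2"
  shows "(A x + A y) * \<phi> z + (B x + B y) = 0"
proof -
  obtain C where C: "\<forall>e e\<^sub>2. (\<forall>t\<in>I. (e has_real_derivative H t * e\<^sub>2 t) (at t)) \<longrightarrow>
      (\<forall>t\<in>I. (e\<^sub>2 has_real_derivative H t * ((\<beta>\<^sup>2 - 4 * \<alpha> * \<gamma>) * e t)) (at t)) \<longrightarrow> e x + e y = C * e z"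
    using midpoint_of_linear_ode[OF I_int h xyz, of "\<beta>\<^sup>2 - 4 * \<alpha> * \<gamma>"] by auto
  have A': "(A has_real_derivative H t * (\<beta> * A t - 2 * \<alpha> * B t)) (at t)"
    and B': "(B has_real_derivative H t * (2 * \<gamma> * A t - \<beta> * B t)) (at t)" if t: "t \<in> I" for t
    using DA[OF t] DB[OF t] unfolding deriv_f_eq_conic[OF t] H[OF t] by (simp_all add: algebra_simps)
  have "((\<lambda>t. \<beta> * A t - 2 * \<alpha> * B t) has_real_derivative H t * ((\<beta>\<^sup>2 - 4 * \<alpha> * \<gamma>) * A t)) (at t)"
    if t: "t \<in> I" for t
    by (rule DERIV_cong[OF DERIV_diff[OF DERIV_cmult[OF A'[OF t]] DERIV_cmult[OF B'[OF t]]]]) algebra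
  then have A_sum: "A x + A y = C * A z"
    using C[rule_format, of A "\<lambda>t. \<beta> * A t - 2 * \<alpha> * B t"] A' by simp
  have "((\<lambda>t. 2 * \<gamma> * A t - \<beta> * B t) has_real_derivative H t * ((\<beta>\<^sup>2 - 4 * \<alpha> * \<gamma>) * B t)) (at t)"
    if t: "t \<in> I" for t
    by (rule DERIV_cong[OF DERIV_diff[OF DERIV_cmult[OF A'[OF t]] DERIV_cmult[OF B'[OF t]]]]) algebra
  then have B_sum: "B x + B y = C * B z"
    using C[rule_format, of B "\<lambda>t. 2 * \<gamma> * A t - \<beta> * B t"] B' by simp
  show ?thesis
    unfolding A_sum B_sum using tangent_\<phi>[OF xyz(3)] by algebra
qed

text \<open>\<open>conic_chord\<close> gives the slope of the chord, and
  \<open>\<phi>_midpoint\<close> shows that it is the tangent slope at the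
  \<open>h\<close>-midpoint.\<close>

lemma M_eq_qa_mean_conic:
  assumes "x \<in> I" "y \<in> I"
  shows "M x y = qa_mean I h x y"
proof -
  have inj: "inj_on h I"
    by (rule inj_on_if_deriv_nonzero[OF I_int h H_nonzero])
  have cont: "continuous_on I h"
    by (rule DERIV_continuous_on) (rule has_field_derivative_at_within[OF h])
  note z = qa_mean[OF I_int cont inj assms]
  show ?thesis
  proof (cases "x = y")
    case True
    then show ?thesis
      using qa_mean_eqI[OF inj assms(1), of x x] by simp
  next
    case False
    have "(A x + A y) * (f x - f y - \<phi> (qa_mean I h x y) * (g x - g y)) = 0"
      using conic_chord[OF assms] \<phi>_midpoint[OF assms z] by algebra
    then have "f x - f y = \<phi> (qa_mean I h x y) * (g x - g y)"
      using A_sum_nonzero[OF assms] by simp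
    then show ?thesis
      by (rule M_eqI[OF assms False z(1)])
  qed
qed

text \<open>Here the quotients by \<open>deriv h\<close> are \<open>- B\<close> and
  \<open>A\<close>, so the Bajraktarevic quotient is the value that \<open>\<phi>\<close> takes at
  the \<open>h\<close>-midpoint.\<close>

lemma bajr_mean_eq_qa_mean_conic:
  assumes xy: "x \<in> I" "y \<in> I"
  shows "bajr_mean I (\<lambda>t. deriv f t / deriv h t) (\<lambda>t. deriv g t / deriv h t) x y = qa_mean I h x y"
proof -
  have inj: "inj_on h I"
    by (rule inj_on_if_deriv_nonzero[OF I_int h H_nonzero])
  have cont: "continuous_on I h"
    by (rule DERIV_continuous_on) (rule has_field_derivative_at_within[OF h])
  note z = qa_mean[OF I_int cont inj xy]
  have h': "deriv h t = H t" if "t \<in> I" for t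
    using DERIV_imp_deriv[OF h[OF that]] .
  have F: "deriv f t / deriv h t = - B t" and G: "deriv g t / deriv h t = A t" if t: "t \<in> I" for t
    using deriv_f_eq_conic[OF t] H[OF t] H_nonzero[OF t] h'[OF t] by auto
  have FG: "deriv f t / deriv h t / (deriv g t / deriv h t) = \<phi> t" if t: "t \<in> I" for t
    using h'[OF t] H_nonzero[OF t] by (simp add: \<phi>_def)
  have "\<phi> (qa_mean I h x y) = (- B x + - B y) / (A x + A y)"
    using \<phi>_midpoint[OF xy z] A_sum_nonzero[OF xy] by (simp add: field_simps)
  moreover have "inj_on (\<lambda>t. deriv f t / deriv h t / (deriv g t / deriv h t)) I"
    by (rule iffD2[OF inj_on_cong[OF FG] inj_\<phi>])
  ultimately show ?thesis
    unfolding bajr_mean_def F[OF xy(1)] F[OF xy(2)] G[OF xy(1)] G[OF xy(2)]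
    using z(1) FG[OF z(1)] by (intro the_inv_into_f_eq) (simp_all only:)
qed

end

lemma quasiarithmetic_if_conic:
  "\<exists>h. continuous_on I h \<and> strictly_monotone_on I h \<and> (\<forall>x\<in>I. \<forall>y\<in>I. M x y = qa_mean I h x y)"
proof -
  define H where "H x = deriv g x / A x" for x
  have cont_H: "continuous_on I H"
    unfolding H_def[abs_def] by (intro continuous_on_divide continuous_deriv_g continuous_A ballI A_nonzero)
  obtain h where h: "\<And>x. x \<in> I \<Longrightarrow> (h has_real_derivative H x) (at x)"
    by (rule open_interval_antiderivative[OF I_open I_int I_ne cont_H]) (rule that)
  have H: "deriv g x = A x * H x" if "x \<in> I" for x
    using A_nonzero[OF that] by (simp add: H_def)
  have "continuous_on I h"
    by (rule DERIV_continuous_on) (rule has_field_derivative_at_within[OF h])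
  moreover have "strictly_monotone_on I h"
    by (rule strictly_monotone_on_if_deriv_nonzero[OF I_int h H_nonzero[OF h H] cont_H])
  moreover have "M x y = qa_mean I h x y" if "x \<in> I" "y \<in> I" for x y
    by (rule M_eq_qa_mean_conic[OF h H that])
  ultimately show ?thesis
    by blast
qed

end

text \<open>Under \<open>h\<close> both sides become the average of the four values.\<close>

lemma bisymmetric_if_quasiarithmetic:
  assumes h: "continuous_on I h" "strictly_monotone_on I h"
    and eq: "\<And>x y. x \<in> I \<Longrightarrow> y \<in> I \<Longrightarrow> M x y = qa_mean I h x y"
  shows M_bisymmetric
  unfolding M_bisymmetric_def
proof (intro ballI)
  note inj = strictly_monotone_on_imp_inj_on[OF h(2)]
  have hM: "h (M x y) = (h x + h y) / 2" if "x \<in> I" "y \<in> I" for x y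
    using qa_mean(2)[OF I_int h(1) inj that] eq[OF that] by simp
  fix x y u v assume mem: "x \<in> I" "y \<in> I" "u \<in> I" "v \<in> I"
  have "h (M (M x y) (M u v)) = h (M (M x u) (M y v))"
    by (simp add: hM M_in mem add_divide_distrib)
  then show "M (M x y) (M u v) = M (M x u) (M y v)"
    by (rule inj_onD[OF inj]) (intro M_in mem)+
qed

end

subsection \<open>Normalized conics\<close>

locale cauchy_pair2 = cauchy_pair +
  assumes C2: "class_Cn 2 I f g"
begin

definition W :: "real \<Rightarrow> real" where
  "W x = deriv (deriv f) x * deriv g x - deriv f x * deriv (deriv g) x"

definition w :: "real \<Rightarrow> real" where
  "w x = root 3 (W x)"

lemma Wron21_eq: "Wron 2 1 f g x = W x"
  by (simp add: Wron_def W_def numeral_2_eq_2)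

lemma pow3_Wron21: "pow3 (Wron 2 1 f g x) n = w x ^ n"
  by (simp only: pow3_def w_def Wron21_eq)

lemma DDf: "x \<in> I \<Longrightarrow> (deriv f has_real_derivative deriv (deriv f) x) (at x)"
  and DDg: "x \<in> I \<Longrightarrow> (deriv g has_real_derivative deriv (deriv g) x) (at x)"
  and continuous_DDf: "continuous_on I (deriv (deriv f))"
  and continuous_DDg: "continuous_on I (deriv (deriv g))"
  using C2 unfolding class_Cn_def Cn_on_def by (auto simp: numeral_2_eq_2 less_Suc_eq)

lemma W_nonzero:
  assumes x: "x \<in> I"
  shows "W x \<noteq> 0"
proof -
  have "((\<lambda>t. deriv f t / deriv g t) has_real_derivative
      (deriv (deriv f) x * deriv g x - deriv f x * deriv (deriv g) x) / (deriv g x * deriv g x)) (at x)"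
    by (rule DERIV_divide[OF DDf[OF x] DDg[OF x] deriv_g_nonzero[OF x]])
  then have "deriv (\<lambda>t. deriv f t / deriv g t) x = W x / (deriv g x * deriv g x)"
    unfolding W_def by (rule DERIV_imp_deriv)
  moreover have "deriv (\<lambda>t. deriv f t / deriv g t) x \<noteq> 0"
    using C2 x unfolding class_Cn_def by blast
  ultimately show ?thesis
    by auto
qed

lemma w_nonzero: "x \<in> I \<Longrightarrow> w x \<noteq> 0"
  using W_nonzero by (simp add: w_def)

lemma w_cubed: "w x ^ 3 = W x"
  by (simp add: w_def odd_real_root_pow)

lemma continuous_w: "continuous_on I w"
  unfolding w_def[abs_def] W_def[abs_def]
  by (intro continuous_intros continuous_deriv_f continuous_deriv_g continuous_DDf continuous_DDg)

lemma obtain_antiderivative_w: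
  obtains h where "\<And>x. x \<in> I \<Longrightarrow> (h has_real_derivative w x) (at x)"
  by (rule open_interval_antiderivative[OF I_open I_int I_ne continuous_w]) (rule that)

text \<open>The tangent equation is differentiated once more, and \<open>B\<close> is eliminated by
  means of the tangent equation itself.\<close>

lemma W_eq_conic:
  assumes conic: "conic_relation \<alpha> \<beta> \<gamma> \<delta> \<epsilon> \<eta>" and x: "x \<in> I"
  shows "W x * A \<alpha> \<beta> \<delta> x = - 2 * (\<alpha> * (deriv f x)\<^sup>2 + \<beta> * deriv f x * deriv g x + \<gamma> * (deriv g x)\<^sup>2) * deriv g x"
proof -
  have "((\<lambda>x. A \<alpha> \<beta> \<delta> x * deriv f x + B \<beta> \<gamma> \<epsilon> x * deriv g x) has_real_derivative
      (2 * \<alpha> * deriv f x + \<beta> * deriv g x) * deriv f x + deriv (deriv f) x * A \<alpha> \<beta> \<delta> x +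
      ((\<beta> * deriv f x + 2 * \<gamma> * deriv g x) * deriv g x + deriv (deriv g) x * B \<beta> \<gamma> \<epsilon> x)) (at x)"
    by (intro DERIV_add DERIV_mult DA[OF conic x] DB[OF conic x] DDf[OF x] DDg[OF x])
  from deriv_zero_if_constant_on_open[OF I_open x _ this, OF tangent[OF conic]]
  have "(2 * \<alpha> * deriv f x + \<beta> * deriv g x) * deriv f x + deriv (deriv f) x * A \<alpha> \<beta> \<delta> x +
      ((\<beta> * deriv f x + 2 * \<gamma> * deriv g x) * deriv g x + deriv (deriv g) x * B \<beta> \<gamma> \<epsilon> x) = 0"
    by blast
  then show ?thesis
    unfolding W_def using tangent[OF conic x] by algebra
qed

text \<open>As the bracket is constant on \<open>I\<close>, this makes \<open>w\<close> a constant
  multiple of \<open>g' / A\<close>.\<close>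

lemma W_cubed_conic:
  assumes conic: "conic_relation \<alpha> \<beta> \<gamma> \<delta> \<epsilon> \<eta>" and x: "x \<in> I"
  shows "W x * A \<alpha> \<beta> \<delta> x ^ 3 = - 2 * (\<alpha> * (B \<beta> \<gamma> \<epsilon> x)\<^sup>2 - \<beta> * (A \<alpha> \<beta> \<delta> x * B \<beta> \<gamma> \<epsilon> x)
    + \<gamma> * (A \<alpha> \<beta> \<delta> x)\<^sup>2) * deriv g x ^ 3"
  using W_eq_conic[OF assms] quadratic_form_deriv[OF assms] by algebra

text \<open>Scaling the coefficients scales \<open>A\<close> but not the curve, so the constant
  factor between \<open>w\<close> and \<open>g' / A\<close> can be absorbed.\<close>

lemma normalized_conic:
  assumes conic: "conic_relation \<alpha> \<beta> \<gamma> \<delta> \<epsilon> \<eta>"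
  obtains \<alpha>' \<beta>' \<gamma>' \<delta>' \<epsilon>' \<eta>' where "conic_relation \<alpha>' \<beta>' \<gamma>' \<delta>' \<epsilon>' \<eta>'"
    "\<And>x. x \<in> I \<Longrightarrow> deriv g x = A \<alpha>' \<beta>' \<delta>' x * w x"
proof -
  obtain x0 where x0: "x0 \<in> I" using I_ne by blast
  define d where "d = \<alpha> * (B \<beta> \<gamma> \<epsilon> x0)\<^sup>2 - \<beta> * (A \<alpha> \<beta> \<delta> x0 * B \<beta> \<gamma> \<epsilon> x0) + \<gamma> * (A \<alpha> \<beta> \<delta> x0)\<^sup>2"
  define \<rho> where "\<rho> = root 3 (- 2 * d)"
  have W_eq: "W x = - 2 * d * (deriv g x / A \<alpha> \<beta> \<delta> x) ^ 3" if x: "x \<in> I" for x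
    using W_cubed_conic[OF conic x] conic_disc_constant[OF conic x x0] A_nonzero[OF conic x]
    by (simp add: d_def power_divide eq_divide_eq)
  have w_eq: "w x = \<rho> * (deriv g x / A \<alpha> \<beta> \<delta> x)" if x: "x \<in> I" for x
    unfolding w_def \<rho>_def W_eq[OF x] real_root_mult by (simp add: odd_real_root_power_cancel)
  have \<rho>: "\<rho> \<noteq> 0"
    using w_eq[OF x0] w_nonzero[OF x0] by auto
  show ?thesis
  proof (rule that[of "\<alpha> / \<rho>" "\<beta> / \<rho>" "\<gamma> / \<rho>" "\<delta> / \<rho>" "\<epsilon> / \<rho>" "\<eta> / \<rho>"])
    have "\<alpha> / \<rho> * (f x)\<^sup>2 + \<beta> / \<rho> * f x * g x + \<gamma> / \<rho> * (g x)\<^sup>2 + \<delta> / \<rho> * f x + \<epsilon> / \<rho> * g x + \<eta> / \<rho>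
      = (\<alpha> * (f x)\<^sup>2 + \<beta> * f x * g x + \<gamma> * (g x)\<^sup>2 + \<delta> * f x + \<epsilon> * g x + \<eta>) / \<rho>" for x
      by (simp add: add_divide_distrib)
    then show conic': "conic_relation (\<alpha> / \<rho>) (\<beta> / \<rho>) (\<gamma> / \<rho>) (\<delta> / \<rho>) (\<epsilon> / \<rho>) (\<eta> / \<rho>)"
      using conic \<rho> unfolding conic_relation_def by simp
    fix x assume x: "x \<in> I"
    have "A (\<alpha> / \<rho>) (\<beta> / \<rho>) (\<delta> / \<rho>) x = A \<alpha> \<beta> \<delta> x / \<rho>"
      unfolding A_def[OF conic] A_def[OF conic'] by (simp add: add_divide_distrib)
    then show "deriv g x = A (\<alpha> / \<rho>) (\<beta> / \<rho>) (\<delta> / \<rho>) x * w x"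
      using w_eq[OF x] A_nonzero[OF conic x] \<rho> by simp
  qed
qed

lemma quadratic_form_if_conic:
  assumes conic: "conic_relation \<alpha> \<beta> \<gamma> \<delta> \<epsilon> \<eta>"
  shows "\<exists>a b c. \<forall>x\<in>I. a * (deriv f x)\<^sup>2 + b * deriv f x * deriv g x + c * (deriv g x)\<^sup>2 = (w x)\<^sup>2"
proof -
  obtain \<alpha>' \<beta>' \<gamma>' \<delta>' \<epsilon>' \<eta>' where conic': "conic_relation \<alpha>' \<beta>' \<gamma>' \<delta>' \<epsilon>' \<eta>'"
    and w: "\<And>x. x \<in> I \<Longrightarrow> deriv g x = A \<alpha>' \<beta>' \<delta>' x * w x"
    by (rule normalized_conic[OF conic]) (rule that)
  \<comment> \<open>The coefficients come from \<open>W_eq_conic\<close>: with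
    \<open>g' = A * w\<close> and \<open>W\<close> the cube of \<open>w\<close>, the factor
    \<open>A * w\<close> cancels.\<close>
  have "- 2 * \<alpha>' * (deriv f x)\<^sup>2 + - 2 * \<beta>' * deriv f x * deriv g x + - 2 * \<gamma>' * (deriv g x)\<^sup>2 = (w x)\<^sup>2"
    if x: "x \<in> I" for x
  proof -
    have "A \<alpha>' \<beta>' \<delta>' x * w x * (w x)\<^sup>2 = W x * A \<alpha>' \<beta>' \<delta>' x"
      by (simp add: power2_eq_square power3_eq_cube flip: w_cubed)
    also have "\<dots> = A \<alpha>' \<beta>' \<delta>' x * w x *
        (- 2 * \<alpha>' * (deriv f x)\<^sup>2 + - 2 * \<beta>' * deriv f x * deriv g x + - 2 * \<gamma>' * (deriv g x)\<^sup>2)"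
      unfolding W_eq_conic[OF conic' x] w[OF x] by algebra
    finally show ?thesis
      using A_nonzero[OF conic' x] w_nonzero[OF x] by simp
  qed
  then show ?thesis
    by blast
qed

lemma means_eq_qa_mean_if_conic:
  assumes conic: "conic_relation \<alpha> \<beta> \<gamma> \<delta> \<epsilon> \<eta>"
    and h: "\<And>x. x \<in> I \<Longrightarrow> (h has_real_derivative w x) (at x)" and xy: "x \<in> I" "y \<in> I"
  shows "M x y = qa_mean I h x y"
    "bajr_mean I (\<lambda>t. deriv f t / deriv h t) (\<lambda>t. deriv g t / deriv h t) x y = qa_mean I h x y"
proof -
  obtain \<alpha>' \<beta>' \<gamma>' \<delta>' \<epsilon>' \<eta>' where conic': "conic_relation \<alpha>' \<beta>' \<gamma>' \<delta>' \<epsilon>' \<eta>'"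
    and w: "\<And>x. x \<in> I \<Longrightarrow> deriv g x = A \<alpha>' \<beta>' \<delta>' x * w x"
    by (rule normalized_conic[OF conic]) (rule that)
  show "M x y = qa_mean I h x y"
    by (rule M_eq_qa_mean_conic[OF conic' h w xy])
  show "bajr_mean I (\<lambda>t. deriv f t / deriv h t) (\<lambda>t. deriv g t / deriv h t) x y = qa_mean I h x y"
    by (rule bajr_mean_eq_qa_mean_conic[OF conic' h w xy])
qed

subsection \<open>The quadratic form in the derivatives\<close>

context
  fixes a b c :: real
  assumes form: "\<And>x. x \<in> I \<Longrightarrow> a * (deriv f x)\<^sup>2 + b * deriv f x * deriv g x + c * (deriv g x)\<^sup>2 = (w x)\<^sup>2"
begin

text \<open>Differentiating the form yields \<open>w'\<close>. In the quotient rule a factor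
  \<open>W\<close> then cancels against the cube of \<open>w\<close>, which leaves linear
  combinations of \<open>f'\<close> and \<open>g'\<close> that can be integrated.\<close>

lemma deriv_F_if_form: "x \<in> I \<Longrightarrow>
    ((\<lambda>t. deriv f t / w t) has_real_derivative (b * deriv f x + 2 * c * deriv g x) / 2) (at x)"
  and deriv_G_if_form: "x \<in> I \<Longrightarrow>
    ((\<lambda>t. deriv g t / w t) has_real_derivative - (2 * a * deriv f x + b * deriv g x) / 2) (at x)"
proof -
  assume x: "x \<in> I"
  define D where "D = a * (2 * deriv f x * deriv (deriv f) x)
    + b * (deriv (deriv f) x * deriv g x + deriv f x * deriv (deriv g) x)
    + c * (2 * deriv g x * deriv (deriv g) x)"
  have "((\<lambda>t. a * (deriv f t)\<^sup>2 + b * deriv f t * deriv g t + c * (deriv g t)\<^sup>2) has_real_derivative D) (at x)"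
    unfolding power2_eq_square
    by (rule DERIV_cong, (rule DERIV_add DERIV_cmult DDf[OF x] DDg[OF x] DERIV_mult)+)
      (simp add: D_def algebra_simps)
  then have "((\<lambda>t. (w t)\<^sup>2) has_real_derivative D) (at x)"
    by (rule has_field_derivative_transform_within_open[OF _ I_open x form])
  then have w': "(w has_real_derivative D / (2 * w x)) (at x)"
    by (rule has_real_derivative_if_square_has_real_derivative[OF I_open continuous_w x w_nonzero[OF x]])
  have w: "w x \<noteq> 0" by (rule w_nonzero[OF x])
  have eqs: "2 * (w x)\<^sup>2 * deriv (deriv f) x - deriv f x * D = w x ^ 3 * (b * deriv f x + 2 * c * deriv g x)"
    "2 * (w x)\<^sup>2 * deriv (deriv g) x - deriv g x * D = w x ^ 3 * - (2 * a * deriv f x + b * deriv g x)"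
    unfolding w_cubed W_def form[OF x, symmetric] D_def by algebra+
  have quot: "(y2 * w x - y1 * (D / (2 * w x))) / (w x * w x) = Y / 2"
    if "2 * (w x)\<^sup>2 * y2 - y1 * D = w x ^ 3 * Y" for y1 y2 Y
  proof -
    have "(y2 * w x - y1 * (D / (2 * w x))) / (w x * w x) = (2 * (w x)\<^sup>2 * y2 - y1 * D) / (2 * w x ^ 3)"
      using w by (simp add: field_simps power2_eq_square power3_eq_cube)
    then show ?thesis
      unfolding that using w by simp
  qed
  show "((\<lambda>t. deriv f t / w t) has_real_derivative (b * deriv f x + 2 * c * deriv g x) / 2) (at x)"
    by (rule DERIV_cong[OF DERIV_divide[OF DDf[OF x] w' w]]) (rule quot[OF eqs(1)])
  show "((\<lambda>t. deriv g t / w t) has_real_derivative - (2 * a * deriv f x + b * deriv g x) / 2) (at x)"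
    by (rule DERIV_cong[OF DERIV_divide[OF DDg[OF x] w' w]]) (rule quot[OF eqs(2)])
qed

lemma conic_if_form: "\<exists>\<alpha> \<beta> \<gamma> \<delta> \<epsilon> \<eta>. conic_relation \<alpha> \<beta> \<gamma> \<delta> \<epsilon> \<eta>"
proof -
  obtain x0 where x0: "x0 \<in> I" using I_ne by blast
  \<comment> \<open>The integrated identities: \<open>f' / w\<close> and \<open>g' / w\<close> are
    affine in \<open>f\<close> and \<open>g\<close>. The summand 0 matches the shape of
    \<open>D_affine\<close>.\<close>
  define p where "p x = deriv f x / w x - (b / 2 * f x + c * g x + 0)" for x
  define q where "q x = deriv g x / w x - (- a * f x + (- b / 2) * g x + 0)" for x
  have p: "p x = p x0" and q: "q x = q x0" if x: "x \<in> I" for x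
  proof -
    show "p x = p x0" unfolding p_def
      by (rule constant_if_deriv_zero_on_interval[OF I_int _ x x0],
          rule DERIV_cong, rule DERIV_diff, rule deriv_F_if_form, assumption, rule D_affine, assumption) simp
    show "q x = q x0" unfolding q_def
      by (rule constant_if_deriv_zero_on_interval[OF I_int _ x x0],
          rule DERIV_cong, rule DERIV_diff, rule deriv_G_if_form, assumption, rule D_affine, assumption) simp
  qed
  \<comment> \<open>The linear terms are chosen so that the gradient of the polynomial is
    \<open>- 2 * g' / w\<close> and \<open>2 * f' / w\<close>, orthogonal to the velocity.\<close>
  define Q where "Q x = a * (f x)\<^sup>2 + b * f x * g x + c * (g x)\<^sup>2 + (- 2 * q x0) * f x + (2 * p x0) * g x" for x
  have "(Q has_real_derivative 0) (at x)" if x: "x \<in> I" for x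
  proof -
    have F: "deriv f x = (p x0 + b / 2 * f x + c * g x) * w x"
      and G: "deriv g x = (q x0 - a * f x - b / 2 * g x) * w x"
      using p[OF x] q[OF x] w_nonzero[OF x] unfolding p_def[of x] q_def[of x] by (simp_all add: field_simps)
    show ?thesis
      unfolding Q_def[abs_def] power2_eq_square
      by (rule DERIV_cong, (rule DERIV_add DERIV_cmult Df[OF x] Dg[OF x] DERIV_mult)+)
        (simp add: F G algebra_simps)
  qed
  then have "Q x = Q x0" if "x \<in> I" for x
    using constant_if_deriv_zero_on_interval[OF I_int _ that x0] by blast
  moreover have "(a, b, c) \<noteq> (0, 0, 0)"
    using form[OF x0] w_nonzero[OF x0] by auto
  ultimately have "conic_relation a b c (- 2 * q x0) (2 * p x0) (- Q x0)"
    unfolding conic_relation_def Q_def by simp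
  then show ?thesis
    by blast
qed

end

subsection \<open>Recovering the Cauchy mean from the Bajraktarevic mean\<close>

text \<open>As \<open>G = g' / w\<close> keeps its sign, the Bajraktarevic quotient is a convex
  combination of \<open>\<phi> x\<close> and \<open>\<phi> y\<close>, hence a value of
  \<open>\<phi>\<close>, so the inverse in \<open>bajr_mean\<close> is a true one.\<close>

lemma \<phi>_bajr_mean:
  assumes h: "\<And>x. x \<in> I \<Longrightarrow> (h has_real_derivative w x) (at x)" and xy: "x \<in> I" "y \<in> I"
  defines "z \<equiv> bajr_mean I (\<lambda>t. deriv f t / deriv h t) (\<lambda>t. deriv g t / deriv h t) x y"
  shows "\<phi> z * (deriv g x / w x + deriv g y / w y) = deriv f x / w x + deriv f y / w y"
proof -
  define F where "F t = deriv f t / w t" for t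
  define G where "G t = deriv g t / w t" for t
  have F: "F t = \<phi> t * G t" if "t \<in> I" for t
    using deriv_f_eq[OF that] by (simp add: F_def G_def)
  have G_nz: "G t \<noteq> 0" if "t \<in> I" for t
    using deriv_g_nonzero[OF that] w_nonzero[OF that] by (simp add: G_def)
  have "continuous_on I G"
    unfolding G_def[abs_def] by (intro continuous_on_divide continuous_deriv_g continuous_w ballI w_nonzero)
  then have sgn_G: "sgn (G x) = sgn (G y)"
    by (rule sgn_eq_if_nonzero_on_interval[OF I_int _ G_nz xy])
  define r where "r = \<bar>G x\<bar> / (\<bar>G x\<bar> + \<bar>G y\<bar>)"
  have r: "0 \<le> r" "0 \<le> 1 - r"
    using G_nz[OF xy(1)] unfolding r_def by (auto simp: field_simps)
  have sum_nz: "G x + G y \<noteq> 0"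
    using sgn_G G_nz[OF xy(1)] by (auto simp: sgn_real_def split: if_splits)
  have r_eq: "r = G x / (G x + G y)"
  proof (cases "G x > 0")
    case True
    then have "G y > 0" using sgn_G by (auto simp: sgn_real_def split: if_splits)
    then show ?thesis using True by (simp add: r_def)
  next
    case False
    then have "G x < 0" "G y < 0"
      using sgn_G G_nz[OF xy(1)] by (auto simp: sgn_real_def split: if_splits)
    then show ?thesis by (simp add: r_def field_simps)
  qed
  have val: "(F x + F y) / (G x + G y) = r * \<phi> x + (1 - r) * \<phi> y"
  proof -
    have "1 - r = G y / (G x + G y)"
      unfolding r_eq using sum_nz by (simp add: field_simps)
    then show ?thesis
      unfolding r_eq F[OF xy(1)] F[OF xy(2)] by (simp add: add_divide_distrib mult.commute)
  qed
  have "r * min (\<phi> x) (\<phi> y) + (1 - r) * min (\<phi> x) (\<phi> y) \<le> r * \<phi> x + (1 - r) * \<phi> y"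
    "r * \<phi> x + (1 - r) * \<phi> y \<le> r * max (\<phi> x) (\<phi> y) + (1 - r) * max (\<phi> x) (\<phi> y)"
    using r by (intro add_mono mult_left_mono; simp)+
  then have bounds: "min (\<phi> x) (\<phi> y) \<le> r * \<phi> x + (1 - r) * \<phi> y"
    "r * \<phi> x + (1 - r) * \<phi> y \<le> max (\<phi> x) (\<phi> y)"
    by (simp_all add: left_diff_distrib)
  obtain t where t: "t \<in> I" "\<phi> t = r * \<phi> x + (1 - r) * \<phi> y"
    by (rule interval_IVT_between[OF I_int continuous_\<phi> xy bounds]) (rule that)
  have h': "deriv h s = w s" if "s \<in> I" for s
    using DERIV_imp_deriv[OF h[OF that]] .
  have FG: "deriv f s / deriv h s / (deriv g s / deriv h s) = \<phi> s" if s: "s \<in> I" for s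
    using h'[OF s] w_nonzero[OF s] by (simp add: \<phi>_def)
  have "inj_on (\<lambda>t. deriv f t / deriv h t / (deriv g t / deriv h t)) I"
    by (rule iffD2[OF inj_on_cong[OF FG] inj_\<phi>])
  then have "z = t"
    unfolding z_def bajr_mean_def h'[OF xy(1)] h'[OF xy(2)]
    using FG[OF t(1)] t val unfolding F_def G_def by (intro the_inv_into_f_eq) (simp_all only:)
  then have "\<phi> z = (F x + F y) / (G x + G y)"
    using t val by simp
  then show ?thesis
    using sum_nz unfolding F_def G_def by simp
qed

text \<open>In the parameter \<open>h\<close>, the chord condition for the Cauchy mean is the integral of the
  condition for the Bajraktarevic mean over intervals symmetric about the midpoint.\<close>

lemma M_eq_qa_mean_if_bajr:
  assumes h: "\<And>x. x \<in> I \<Longrightarrow> (h has_real_derivative w x) (at x)"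
    and bajr: "\<And>x y. x \<in> I \<Longrightarrow> y \<in> I \<Longrightarrow>
      bajr_mean I (\<lambda>t. deriv f t / deriv h t) (\<lambda>t. deriv g t / deriv h t) x y = qa_mean I h x y"
    and xy: "x \<in> I" "y \<in> I"
  shows "M x y = qa_mean I h x y"
proof -
  have inj: "inj_on h I"
    by (rule inj_on_if_deriv_nonzero[OF I_int h w_nonzero])
  have cont: "continuous_on I h"
    by (rule DERIV_continuous_on) (rule has_field_derivative_at_within[OF h])
  define z where "z = qa_mean I h x y"
  have z: "z \<in> I" "h z = (h x + h y) / 2"
    using qa_mean[OF I_int cont inj xy] unfolding z_def by auto
  define k where "k = the_inv_into I h"
  have kh: "k (h t) = t" if "t \<in> I" for t
    using the_inv_into_f_f[OF inj that] by (simp add: k_def)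
  have Dk: "(k has_real_derivative inverse (w t)) (at (h t))" if t: "t \<in> I" for t
    unfolding has_field_derivative_def
  proof (rule has_derivative_inverse_strong[OF I_open t cont kh])
    show "(h has_derivative (*) (w t)) (at t)"
      using h[OF t] unfolding has_field_derivative_def .
    show "(*) (w t) \<circ> (*) (inverse (w t)) = id"
      using w_nonzero[OF t] by (auto simp: fun_eq_iff)
  qed
  define u where "u = h z"
  define T where "T = {t. u + t \<in> h ` I \<and> u - t \<in> h ` I}"
  have int_hI: "is_interval (h ` I)"
    using I_int cont connected_continuous_image is_interval_connected_1 by blast
  have T: "is_interval T"
    unfolding is_interval_1
  proof (intro ballI allI impI)
    fix a b t assume "a \<in> T" "b \<in> T" "a \<le> t \<and> t \<le> b"
    moreover have "v \<in> h ` I" if "p \<in> h ` I" "q \<in> h ` I" "p \<le> v" "v \<le> q" for p q v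
      using int_hI that unfolding is_interval_1 by blast
    ultimately show "t \<in> T"
      unfolding T_def by (smt (verit, best) mem_Collect_eq)
  qed
  \<comment> \<open>The defect of the chord condition over the parameters \<open>u - t\<close> and
    \<open>u + t\<close>, with the slope at \<open>z\<close> held fixed. It vanishes at 0, and
    \<open>t = h x - u\<close> gives the chord over \<open>x\<close> and \<open>y\<close>.\<close>
  define E where "E t = (f (k (u + t)) - f (k (u - t))) - \<phi> z * (g (k (u + t)) - g (k (u - t)))" for t
  have "(E has_real_derivative 0) (at t)" if tT: "t \<in> T" for t
  proof -
    obtain a b where ab: "a \<in> I" "b \<in> I" "u + t = h a" "u - t = h b"
      using tT unfolding T_def by blast
    have k_plus: "((\<lambda>t. k (u + t)) has_real_derivative inverse (w a)) (at t)"
      and k_minus: "((\<lambda>t. k (u - t)) has_real_derivative - inverse (w b)) (at t)"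
    proof -
      have "((\<lambda>t. u + t) has_real_derivative 1) (at t)" "((\<lambda>t. u - t) has_real_derivative - 1) (at t)"
        by (auto intro!: derivative_eq_intros)
      then show "((\<lambda>t. k (u + t)) has_real_derivative inverse (w a)) (at t)"
        "((\<lambda>t. k (u - t)) has_real_derivative - inverse (w b)) (at t)"
        using DERIV_chain2[of k _ "\<lambda>t. u + t" t 1] DERIV_chain2[of k _ "\<lambda>t. u - t" t "- 1"] Dk ab
        by fastforce+
    qed
    have fa: "(f has_real_derivative deriv f a) (at (k (u + t)))"
      and fb: "(f has_real_derivative deriv f b) (at (k (u - t)))"
      and ga: "(g has_real_derivative deriv g a) (at (k (u + t)))"
      and gb: "(g has_real_derivative deriv g b) (at (k (u - t)))"
      using Df Dg ab kh by simp_all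
    have "h z = (h a + h b) / 2"
      using ab(3,4) unfolding u_def by (simp add: field_simps)
    then have "qa_mean I h a b = z"
      by (rule qa_mean_eqI[OF inj z(1)])
    then have "\<phi> z * (deriv g a / w a + deriv g b / w b) = deriv f a / w a + deriv f b / w b"
      using \<phi>_bajr_mean[OF h ab(1,2)] bajr[OF ab(1,2)] by simp
    then show ?thesis
      unfolding E_def[abs_def]
      by (intro DERIV_cong[OF DERIV_diff[OF DERIV_diff[OF DERIV_chain2[OF fa k_plus] DERIV_chain2[OF fb k_minus]]
            DERIV_cmult[OF DERIV_diff[OF DERIV_chain2[OF ga k_plus] DERIV_chain2[OF gb k_minus]]]]])
        (simp add: field_simps)
  qed
  moreover have "0 \<in> T" "h x - u \<in> T"
    using z xy unfolding T_def u_def by (auto simp: field_simps)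
  ultimately have "E (h x - u) = E 0"
    using constant_if_deriv_zero_on_interval[OF T] by blast
  moreover have "u - (h x - u) = h y"
    using z(2) unfolding u_def by (simp add: field_simps)
  ultimately have chord: "f x - f y = \<phi> z * (g x - g y)"
    unfolding E_def using kh xy by simp
  show ?thesis
  proof (cases "x = y")
    case True
    then show ?thesis
      using qa_mean_eqI[OF inj xy(1), of x x] by simp
  next
    case False
    then show ?thesis
      using M_eqI[OF xy False z(1) chord] unfolding z_def by simp
  qed
qed

subsection \<open>The fourth-order invariant\<close>

definition vii_expr :: "real \<Rightarrow> real" where
  "vii_expr x = (3 * Wron 4 1 f g x + 12 * Wron 3 2 f g x) / w x ^ 5 - 5 * (Wron 3 1 f g x)\<^sup>2 / w x ^ 8"

text \<open>The derivative of the cube root \<open>w\<close>, as \<open>D_w\<close>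
  confirms.\<close>

definition w\<^sub>1 :: "real \<Rightarrow> real" where
  "w\<^sub>1 x = Wron 3 1 f g x / (3 * (w x)\<^sup>2)"

text \<open>The second derivative of \<open>y' / w\<close>, where \<open>y\<close> is \<open>f\<close> or \<open>g\<close>, with respect to an
  antiderivative of \<open>w\<close> is \<open>- vii_expr / 9\<close> times \<open>y' / w\<close>; \<open>first_deriv y\<close> is the first one.\<close>

definition first_deriv :: "(real \<Rightarrow> real) \<Rightarrow> real \<Rightarrow> real" where
  "first_deriv y x = ((deriv ^^ 2) y x * w x - (deriv ^^ 1) y x * w\<^sub>1 x) / w x ^ 3"

context
  assumes C4: "class_Cn 4 I f g"
begin

lemma higher_Df: "k < 4 \<Longrightarrow> x \<in> I \<Longrightarrow> ((deriv ^^ k) f has_real_derivative (deriv ^^ Suc k) f x) (at x)"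
  and higher_Dg: "k < 4 \<Longrightarrow> x \<in> I \<Longrightarrow> ((deriv ^^ k) g has_real_derivative (deriv ^^ Suc k) g x) (at x)"
  using C4 unfolding class_Cn_def Cn_on_def by blast+

lemma D_Wron:
  assumes "i < 4" "j < 4" "x \<in> I"
  shows "(Wron i j f g has_real_derivative Wron (Suc i) j f g x + Wron i (Suc j) f g x) (at x)"
  unfolding Wron_def[abs_def]
  by (rule DERIV_cong[OF DERIV_diff[OF DERIV_mult[OF higher_Df higher_Dg] DERIV_mult[OF higher_Df higher_Dg]]])
    (use assms in \<open>simp_all add: algebra_simps\<close>)

lemma D_w:
  assumes x: "x \<in> I"
  shows "(w has_real_derivative w\<^sub>1 x) (at x)"
proof -
  \<comment> \<open>The other term of \<open>D_Wron\<close> is \<open>Wron 2 2\<close>, which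
    vanishes.\<close>
  have "(Wron 2 1 f g has_real_derivative Wron 3 1 f g x) (at x)"
    using D_Wron[OF _ _ x, of 2 1] by (simp add: Wron_def numeral_eq_Suc)
  then have DW: "(W has_real_derivative Wron 3 1 f g x) (at x)"
    unfolding Wron21_eq[abs_def] .
  have "(root 3 has_real_derivative inverse (real 3 * root 3 (W x) ^ (3 - Suc 0))) (at (W x))"
    by (rule DERIV_odd_real_root) (use W_nonzero[OF x] in auto)
  from DERIV_chain2[OF this DW]
  have "(w has_real_derivative inverse (real 3 * root 3 (W x) ^ (3 - Suc 0)) * Wron 3 1 f g x) (at x)"
    unfolding w_def[abs_def] .
  moreover have "inverse (real 3 * r ^ (3 - Suc 0)) * v = v / (3 * r\<^sup>2)" for r v :: real
    by (simp add: field_simps)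
  ultimately show ?thesis
    by (simp only: w\<^sub>1_def w_def)
qed

lemma D_w\<^sub>1:
  assumes x: "x \<in> I"
  shows "(w\<^sub>1 has_real_derivative
    (Wron 4 1 f g x + Wron 3 2 f g x) / (3 * (w x)\<^sup>2) - 2 * (Wron 3 1 f g x)\<^sup>2 / (9 * w x ^ 5)) (at x)"
proof -
  have W31: "(Wron 3 1 f g has_real_derivative Wron 4 1 f g x + Wron 3 2 f g x) (at x)"
    using D_Wron[OF _ _ x, of 3 1] by (simp add: numeral_eq_Suc)
  have den: "((\<lambda>x. 3 * (w x)\<^sup>2) has_real_derivative 6 * w x * w\<^sub>1 x) (at x)"
    unfolding power2_eq_square
    by (rule DERIV_cong[OF DERIV_cmult[OF DERIV_mult[OF D_w[OF x] D_w[OF x]]]]) simp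
  have nz: "3 * (w x)\<^sup>2 \<noteq> 0"
    using w_nonzero[OF x] by simp
  show ?thesis
    unfolding w\<^sub>1_def[abs_def]
    by (rule DERIV_cong[OF DERIV_divide[OF W31 den nz]])
      (use w_nonzero[OF x] in \<open>simp add: w\<^sub>1_def field_simps power2_eq_square eval_nat_numeral\<close>)
qed

text \<open>\<open>cramer\<close> is the linear equation of third order satisfied by both
  \<open>f\<close> and \<open>g\<close>. Once it replaces the third derivative, the terms with the
  second derivative cancel.\<close>

lemma D_first_deriv:
  assumes x: "x \<in> I"
    and D: "\<And>k. k < 4 \<Longrightarrow> ((deriv ^^ k) y has_real_derivative (deriv ^^ Suc k) y x) (at x)"
    and cramer: "(deriv ^^ 3) y x * W x = Wron 3 1 f g x * (deriv ^^ 2) y x - Wron 3 2 f g x * deriv y x"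
  shows "((\<lambda>t. deriv y t / w t) has_real_derivative w x * first_deriv y x) (at x)"
    "(first_deriv y has_real_derivative - vii_expr x / 9 * deriv y x) (at x)"
proof -
  define y1 y2 y3 where "y1 = deriv y x" and "y2 = (deriv ^^ 2) y x" and "y3 = (deriv ^^ 3) y x"
  have Dy1: "(deriv y has_real_derivative y2) (at x)" and Dy2: "((deriv ^^ 2) y has_real_derivative y3) (at x)"
    using D[of 1] D[of 2] unfolding y2_def y3_def by (simp_all add: numeral_eq_Suc)
  have w: "w x \<noteq> 0" by (rule w_nonzero[OF x])
  have fd: "first_deriv y = (\<lambda>x. ((deriv ^^ 2) y x * w x - deriv y x * w\<^sub>1 x) / (w x * (w x * w x)))"
    by (simp add: first_deriv_def fun_eq_iff power3_eq_cube)
  show "((\<lambda>t. deriv y t / w t) has_real_derivative w x * first_deriv y x) (at x)"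
    by (rule DERIV_cong[OF DERIV_divide[OF Dy1 D_w[OF x] w]]) (use w in \<open>simp add: fd y2_def\<close>)
  define W31 W32 W41 where "W31 = Wron 3 1 f g x" and "W32 = Wron 3 2 f g x" and "W41 = Wron 4 1 f g x"
  have y3: "y3 = (W31 * y2 - W32 * y1) / w x ^ 3"
    using cramer w unfolding y1_def y2_def y3_def W31_def W32_def w_cubed[symmetric]
    by (simp add: eq_divide_eq)
  have w1: "w\<^sub>1 x = W31 / (3 * (w x)\<^sup>2)"
    by (simp add: w\<^sub>1_def W31_def)
  have nz: "w x * (w x * w x) \<noteq> 0" using w by simp
  show "(first_deriv y has_real_derivative - vii_expr x / 9 * deriv y x) (at x)"
    unfolding fd
  proof (rule DERIV_cong[OF DERIV_divide[OF DERIV_diff[OF DERIV_mult[OF Dy2 D_w[OF x]] DERIV_mult[OF Dy1 D_w\<^sub>1[OF x]]]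
          DERIV_mult[OF D_w[OF x] DERIV_mult[OF D_w[OF x] D_w[OF x]]] nz]])
    show "((y3 * w x + w\<^sub>1 x * (deriv ^^ 2) y x - (y2 * w\<^sub>1 x +
        ((Wron 4 1 f g x + Wron 3 2 f g x) / (3 * (w x)\<^sup>2) - 2 * (Wron 3 1 f g x)\<^sup>2 / (9 * w x ^ 5)) * deriv y x))
        * (w x * (w x * w x)) - ((deriv ^^ 2) y x * w x - deriv y x * w\<^sub>1 x) *
        (w\<^sub>1 x * (w x * w x) + (w\<^sub>1 x * w x + w\<^sub>1 x * w x) * w x)) /
      (w x * (w x * w x) * (w x * (w x * w x))) = - vii_expr x / 9 * deriv y x"
      unfolding vii_expr_def y1_def[symmetric] y2_def[symmetric] W31_def[symmetric] W32_def[symmetric]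
        W41_def[symmetric] w1 y3
      using w by (simp add: field_simps power2_eq_square eval_nat_numeral)
  qed
qed

lemma D_first_deriv_f:
  assumes x: "x \<in> I"
  shows "((\<lambda>t. deriv f t / w t) has_real_derivative w x * first_deriv f x) (at x)"
    "(first_deriv f has_real_derivative - vii_expr x / 9 * deriv f x) (at x)"
  by (rule D_first_deriv[OF x higher_Df[OF _ x]];
      simp add: Wron_def W_def numeral_eq_Suc algebra_simps)+

lemma D_first_deriv_g:
  assumes x: "x \<in> I"
  shows "((\<lambda>t. deriv g t / w t) has_real_derivative w x * first_deriv g x) (at x)"
    "(first_deriv g has_real_derivative - vii_expr x / 9 * deriv g x) (at x)"
  by (rule D_first_deriv[OF x higher_Dg[OF _ x]];
      simp add: Wron_def W_def numeral_eq_Suc algebra_simps)+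

text \<open>With respect to an antiderivative of \<open>w\<close>, \<open>F'' = p F\<close> and
  \<open>G'' = p G\<close> with constant \<open>p\<close>. The three quadratic first integrals
  supply the coefficients, and the squared Wronskian of \<open>F\<close> and \<open>G\<close>, which
  is 1, is the form in \<open>F\<close> and \<open>G\<close>.\<close>

lemma form_if_vii:
  assumes vii: "\<And>x. x \<in> I \<Longrightarrow> vii_expr x = C"
  shows "\<exists>a b c. \<forall>x\<in>I. a * (deriv f x)\<^sup>2 + b * deriv f x * deriv g x + c * (deriv g x)\<^sup>2 = (w x)\<^sup>2"
proof -
  define p where "p = - C / 9"
  define F where "F t = deriv f t / w t" for t
  define G where "G t = deriv g t / w t" for t
  define F1 where "F1 = first_deriv f"
  define G1 where "G1 = first_deriv g"
  have f': "deriv f x = w x * F x" and g': "deriv g x = w x * G x" if "x \<in> I" for x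
    using w_nonzero[OF that] by (simp_all add: F_def G_def)
  have DF: "(F has_real_derivative w x * F1 x) (at x)"
    and DF1: "(F1 has_real_derivative p * (w x * F x)) (at x)"
    and DG: "(G has_real_derivative w x * G1 x) (at x)"
    and DG1: "(G1 has_real_derivative p * (w x * G x)) (at x)" if x: "x \<in> I" for x
    using D_first_deriv_f[OF x] D_first_deriv_g[OF x] vii[OF x]
    unfolding F_def[abs_def] G_def[abs_def] F1_def G1_def p_def
    using w_nonzero[OF x] by simp_all
  have det: "F1 x * G x - F x * G1 x = 1" if x: "x \<in> I" for x
  proof -
    have "F1 x * G x - F x * G1 x = W x / w x ^ 3"
      using w_nonzero[OF x] unfolding F1_def G1_def first_deriv_def F_def G_def W_def
      by (simp add: field_simps numeral_eq_Suc)
    then show ?thesis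
      using w_nonzero[OF x] by (simp flip: w_cubed)
  qed
  obtain x0 where x0: "x0 \<in> I" using I_ne by blast
  define c1 where "c1 = F1 x0 * F1 x0 - p * (F x0 * F x0)"
  define c2 where "c2 = G1 x0 * G1 x0 - p * (G x0 * G x0)"
  define c3 where "c3 = F1 x0 * G1 x0 - p * (F x0 * G x0)"
  have "c2 * (deriv f x)\<^sup>2 + (- 2 * c3) * deriv f x * deriv g x + c1 * (deriv g x)\<^sup>2 = (w x)\<^sup>2"
    if x: "x \<in> I" for x
  proof -
    have cs: "F1 x * F1 x - p * (F x * F x) = c1" "G1 x * G1 x - p * (G x * G x) = c2"
      "F1 x * G1 x - p * (F x * G x) = c3"
      unfolding c1_def c2_def c3_def
      by (rule constant_if_deriv_zero_on_interval[OF I_int _ x x0],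
          rule DERIV_cong, (rule DERIV_diff DERIV_cmult DF DF1 DG DG1 DERIV_mult | assumption)+,
          simp add: algebra_simps)+
    have "c2 * (w x * F x)\<^sup>2 + (- 2 * c3) * (w x * F x) * (w x * G x) + c1 * (w x * G x)\<^sup>2
      = (w x)\<^sup>2 * (F1 x * G x - F x * G1 x)\<^sup>2"
      unfolding cs[symmetric] by algebra
    then show ?thesis
      unfolding det[OF x] f'[OF x] g'[OF x] by simp
  qed
  then show ?thesis
    by blast
qed

text \<open>The form makes the derivatives of \<open>f' / w\<close> and \<open>g' / w\<close> linear
  in \<open>f'\<close> and \<open>g'\<close>. Iterating gives the constant
  \<open>(b\<^sup>2 - 4 * a * c) / 4\<close> in the second-order equation, to be compared with
  \<open>D_first_deriv_g\<close>.\<close>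

lemma vii_if_form:
  assumes form: "\<And>x. x \<in> I \<Longrightarrow> a * (deriv f x)\<^sup>2 + b * deriv f x * deriv g x + c * (deriv g x)\<^sup>2 = (w x)\<^sup>2"
    and x: "x \<in> I"
  shows "vii_expr x = - 9 * ((b\<^sup>2 - 4 * a * c) / 4)"
proof -
  have fd: "(- a) * (deriv f t / w t) + (- b / 2) * (deriv g t / w t) = first_deriv g t" if t: "t \<in> I" for t
  proof -
    have "w t * first_deriv g t = - (2 * a * deriv f t + b * deriv g t) / 2"
      by (rule DERIV_unique[OF D_first_deriv_g(1)[OF t] deriv_G_if_form[OF form t]])
    then show ?thesis
      using w_nonzero[OF t] by (simp add: field_simps)
  qed
  have "((\<lambda>t. (- a) * (deriv f t / w t) + (- b / 2) * (deriv g t / w t)) has_real_derivative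
      (- a) * ((b * deriv f x + 2 * c * deriv g x) / 2) + (- b / 2) * (- (2 * a * deriv f x + b * deriv g x) / 2)) (at x)"
    by (intro DERIV_add DERIV_cmult deriv_F_if_form[OF form x] deriv_G_if_form[OF form x])
  then have "(first_deriv g has_real_derivative
      (- a) * ((b * deriv f x + 2 * c * deriv g x) / 2) + (- b / 2) * (- (2 * a * deriv f x + b * deriv g x) / 2)) (at x)"
    by (rule has_field_derivative_transform_within_open[OF _ I_open x fd])
  then have "- vii_expr x / 9 * deriv g x
      = (- a) * ((b * deriv f x + 2 * c * deriv g x) / 2) + (- b / 2) * (- (2 * a * deriv f x + b * deriv g x) / 2)"
    using DERIV_unique[OF D_first_deriv_g(2)[OF x]] by blast
  then have "(vii_expr x + 9 * ((b\<^sup>2 - 4 * a * c) / 4)) * deriv g x = 0"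
    by (simp add: field_simps power2_eq_square)
  then have "vii_expr x + 9 * ((b\<^sup>2 - 4 * a * c) / 4) = 0"
    using deriv_g_nonzero[OF x] mult_eq_0_iff by blast
  then show ?thesis
    by linarith
qed

end

end

section \<open>The equivalences in the three smoothness classes\<close>

lemma class_Cn_2_if_4:
  assumes "class_Cn 4 I f g"
  shows "class_Cn 2 I f g"
proof -
  have "Cn_on 2 I y" if "Cn_on 4 I y" for y
  proof -
    have D: "\<forall>x\<in>I. ((deriv ^^ k) y has_real_derivative (deriv ^^ Suc k) y x) (at x)" if "k < 4" for k
      using \<open>Cn_on 4 I y\<close> that unfolding Cn_on_def by blast
    have "continuous_on I ((deriv ^^ 2) y)"
      using D[of 2] by (intro DERIV_continuous_on) (auto intro: has_field_derivative_at_within)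
    then show ?thesis
      using D unfolding Cn_on_def by simp
  qed
  then show ?thesis
    using assms unfolding class_Cn_def by blast
qed

theorem theorem2p3:
  fixes I :: "real set" and f g :: "real \<Rightarrow> real"
  assumes I_open: "open I" and I_int: "is_interval I" and I_ne: "I \<noteq> {}"
    and C1: "class_C1 I f g"
  defines "st_i \<equiv> \<exists>h. continuous_on I h \<and> strictly_monotone_on I h \<and>
                 (\<forall>x\<in>I. \<forall>y\<in>I. cauchy_mean I f g x y = qa_mean I h x y)"
    and "st_ii \<equiv> \<forall>x\<in>I. \<forall>y\<in>I. \<forall>u\<in>I. \<forall>v\<in>I.
                 cauchy_mean I f g (cauchy_mean I f g x y) (cauchy_mean I f g u v)
               = cauchy_mean I f g (cauchy_mean I f g x u) (cauchy_mean I f g y v)"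
    and "st_iii \<equiv> \<exists>\<alpha> \<beta> \<gamma> \<delta> \<epsilon> \<eta> :: real. (\<alpha>, \<beta>, \<gamma>) \<noteq> (0, 0, 0) \<and>
                 (\<forall>x\<in>I. \<alpha> * (f x)\<^sup>2 + \<beta> * f x * g x + \<gamma> * (g x)\<^sup>2 + \<delta> * f x + \<epsilon> * g x + \<eta> = 0)"
    and "st_iv \<equiv> \<exists>a b c :: real. \<forall>x\<in>I.
                 a * (deriv f x)\<^sup>2 + b * deriv f x * deriv g x + c * (deriv g x)\<^sup>2
               = pow3 (Wron 2 1 f g x) 2"
    and "st_v \<equiv> \<forall>h. (\<forall>x\<in>I. (h has_real_derivative pow3 (Wron 2 1 f g x) 1) (at x)) \<longrightarrow>
                 (\<forall>x\<in>I. \<forall>y\<in>I.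
                    bajr_mean I (\<lambda>t. deriv f t / deriv h t) (\<lambda>t. deriv g t / deriv h t) x y
                  = qa_mean I h x y)"
    and "st_vi \<equiv> \<forall>h. (\<forall>x\<in>I. (h has_real_derivative pow3 (Wron 2 1 f g x) 1) (at x)) \<longrightarrow>
                 (\<forall>x\<in>I. \<forall>y\<in>I. cauchy_mean I f g x y = qa_mean I h x y)"
    and "st_vii \<equiv> \<exists>C :: real. \<forall>x\<in>I.
                 (3 * Wron 4 1 f g x + 12 * Wron 3 2 f g x) / pow3 (Wron 2 1 f g x) 5
               - 5 * (Wron 3 1 f g x)\<^sup>2 / pow3 (Wron 2 1 f g x) 8 = C"
  shows "(st_i \<longleftrightarrow> st_ii) \<and> (st_i \<longleftrightarrow> st_iii)
       \<and> (class_Cn 2 I f g \<longrightarrow>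
            (st_i \<longleftrightarrow> st_iv) \<and> (st_i \<longleftrightarrow> st_v) \<and> (st_i \<longleftrightarrow> st_vi))
       \<and> (class_Cn 4 I f g \<longrightarrow> (st_i \<longleftrightarrow> st_vii))"
proof -
  interpret cauchy_pair I f g
    by (unfold_locales) (rule I_open I_int I_ne C1)+
  have iii_eq: "st_iii \<longleftrightarrow> (\<exists>\<alpha> \<beta> \<gamma> \<delta> \<epsilon> \<eta>. conic_relation \<alpha> \<beta> \<gamma> \<delta> \<epsilon> \<eta>)"
    unfolding st_iii_def conic_relation_def by blast
  have ii_eq: "st_ii \<longleftrightarrow> M_bisymmetric"
    unfolding st_ii_def M_bisymmetric_def by blast
  have i_ii: "st_i \<Longrightarrow> st_ii"
    unfolding st_i_def ii_eq using bisymmetric_if_quasiarithmetic by blast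
  have ii_iii: "st_ii \<Longrightarrow> st_iii"
    unfolding ii_eq iii_eq by (rule conic_relation_if_bisymmetric)
  have iii_i: "st_iii \<Longrightarrow> st_i"
    unfolding iii_eq st_i_def using quasiarithmetic_if_conic by blast
  \<comment> \<open>(iii) and (iv) imply each other directly; the means are linked by the cycle
    (iii), (v), (vi), (i).\<close>
  have C2_equiv: "(st_iii \<longleftrightarrow> st_iv) \<and> (st_iii \<longleftrightarrow> st_v) \<and> (st_iii \<longleftrightarrow> st_vi)"
    if C2: "class_Cn 2 I f g"
  proof -
    interpret cauchy_pair2 I f g
      by unfold_locales (rule C2)
    \<comment> \<open>(v) and (vi) quantify over all antiderivatives; exhibiting one keeps (vi) from
      being vacuous and supplies the generator for (i).\<close>
    obtain h where h: "\<And>x. x \<in> I \<Longrightarrow> (h has_real_derivative w x) (at x)"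
      by (rule obtain_antiderivative_w) (rule that)
    have "st_iii \<Longrightarrow> st_iv"
      unfolding iii_eq st_iv_def pow3_Wron21 using quadratic_form_if_conic by blast
    moreover have "st_iv \<Longrightarrow> st_iii"
      unfolding iii_eq st_iv_def pow3_Wron21 using conic_if_form by blast
    moreover have "st_iii \<Longrightarrow> st_v" "st_iii \<Longrightarrow> st_vi"
      unfolding iii_eq st_v_def st_vi_def pow3_Wron21 power_one_right using means_eq_qa_mean_if_conic by blast+
    moreover have "st_v \<Longrightarrow> st_vi"
      unfolding st_v_def st_vi_def pow3_Wron21 power_one_right using M_eq_qa_mean_if_bajr by blast
    moreover have "st_i" if vi: "st_vi"
    proof -
      have "continuous_on I h"
        by (rule DERIV_continuous_on) (rule has_field_derivative_at_within[OF h])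
      moreover have "strictly_monotone_on I h"
        by (rule strictly_monotone_on_if_deriv_nonzero[OF I_int h w_nonzero continuous_w])
      moreover have "\<forall>x\<in>I. \<forall>y\<in>I. M x y = qa_mean I h x y"
        using vi h unfolding st_vi_def pow3_Wron21 power_one_right by blast
      ultimately show st_i
        unfolding st_i_def by blast
    qed
    ultimately show ?thesis
      using i_ii ii_iii by blast
  qed
  have C4_equiv: "st_iv \<longleftrightarrow> st_vii" if C4: "class_Cn 4 I f g"
  proof -
    interpret cauchy_pair2 I f g
      by unfold_locales (rule class_Cn_2_if_4[OF C4])
    have vii_eq: "st_vii \<longleftrightarrow> (\<exists>C. \<forall>x\<in>I. vii_expr x = C)"
      unfolding st_vii_def pow3_Wron21 vii_expr_def ..
    show ?thesis
    proof
      assume st_iv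
      then obtain a b c where form: "\<And>x. x \<in> I \<Longrightarrow>
          a * (deriv f x)\<^sup>2 + b * deriv f x * deriv g x + c * (deriv g x)\<^sup>2 = (w x)\<^sup>2"
        unfolding st_iv_def pow3_Wron21 by auto
      show st_vii
        unfolding vii_eq using vii_if_form[OF C4 form] by blast
    next
      assume st_vii
      then obtain C where C: "\<And>x. x \<in> I \<Longrightarrow> vii_expr x = C"
        unfolding vii_eq by auto
      show st_iv
        unfolding st_iv_def pow3_Wron21 by (rule form_if_vii[OF C4 C])
    qed
  qed
  show ?thesis
    using i_ii ii_iii iii_i C2_equiv C4_equiv class_Cn_2_if_4 by blast
qed

end
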